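(* Let $\Omega=\bigcup_{i=1}^n(\alpha_i,\beta_i)$ be a finite union of finite open intervals as in the context. Suppose $\Omega$ is spectral with spectrum $\Lambda$, associated boundary matrix $B=(b_{i,j})$ and associated unitary group $\{U(t)\}_{t\in\mathbb R}$, and suppose $\{U(t)\}$ satisfies the Forelli condition. Let $L:=\mathfrak m(\Omega)=l_1+\dots+l_n$. Then there exist a permutation $\sigma\in S_n$ and $\theta_0\in\mathbb R$ such that: (i) $\sigma$ is a cycle of length $n$, $B$ is a weighted permutation matrix for $\sigma$, and $$b_{i,\sigma(i)}=e^{2\pi \sqrt{-1}\,\frac{\theta_0}{L}(\alpha_{\sigma(i)}-\beta_i)},\quad 1\le i\le n.$$ (ii) All the numbers $\alpha_{\sigma(i)}-\beta_i$, $1\le i\le n$, are in $L\mathbb Z$. (iii) $\Lambda=\frac1L(\mathbb Z-\theta_0)$ and $\Omega$ tiles $\mathbb R$ by $L\mathbb Z$. (iv) For $1\le k\le n-1$ put $\tau_k=\sum_{j=0}^{k-1}(\beta_{\sigma^j(1)}-\alpha_{\sigma^{j+1}(1)})$. Then for each $1\le k\le n-1$ $$(\alpha_{\sigma^k(1)},\beta_{\sigma^k(1)})+\tau_k=\Big(\alpha_1+\sum_{j=0}^{k-1}l_{\sigma^j(1)},\ \alpha_1+\sum_{j=0}^{k}l_{\sigma^j(1)}\Big),$$ the union of $(\alpha_1,\beta_1)$ and of these translated intervals is $(\alpha_1,\alpha_1+L)$ except for finitely many points, all the $\tau_k$ are in $L\mathbb Z$, and consequently these translations show that $\Omega$ is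 translation congruent to $(\alpha_1,\alpha_1+L)$ modulo $L\mathbb Z$.
   Context: Setting: $n\ge 1$, $-\infty<\alpha_1<\beta_1<\alpha_2<\beta_2<\dots<\alpha_n<\beta_n<\infty$, $\Omega=\bigcup_{i=1}^n(\alpha_i,\beta_i)$, $l_i=\beta_i-\alpha_i$; $\mathfrak m$ is Lebesgue measure. $\mathscr D$ is the set of $f\in L^2(\Omega)$ absolutely continuous on each interval with $f'\in L^2(\Omega)$; $f(\alpha_i),f(\beta_i)$ denote the one-sided limits $f(\alpha_i+),f(\beta_i-)$, and $f(\vec\alpha)=(f(\alpha_i))_{i=1}^n$, $f(\vec\beta)=(f(\beta_i))_{i=1}^n$. For a unitary $n\times n$ matrix $B$, $\mathscr D_B=\{f\in\mathscr D: Bf(\vec\alpha)=f(\vec\beta)\}$, $D_Bf=\frac1{2\pi\sqrt{-1}}f'$ with domain $\mathscr D_B$ (a self-adjoint operator), and $U(t)=\exp(2\pi\sqrt{-1}\, tD_B)$. With $e_\lambda(x)=e^{2\pi\sqrt{-1}\lambda x}$, $\Omega$ is spectral with spectrum $\Lambda\subset\mathbb R$ if $\{e_\lambda:\lambda\in\Lambda\}$ is an orthogonal basis of $L^2(\Omega)$. In that case there is a unique unitary matrix $B$ with $Be_\lambda(\vec\alpha)=e_\lambda(\vec\beta)$ for all $\lambda\in\Lambda$ (the associated boundary matrix), and $\Lambda$ is the spectrum of $D_B$; the associated unitary group is that of this $B$. For $g\in L^\infty(\Omega)$ let $M_g$ be the multiplication operator $M_gf=gf$ on $L^2(\Omega)$,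 and $\mathcal M=\{M_g:g\in L^\infty(\Omega)\}$. The group $\{U(t)\}$ satisfies the Forelli condition if $U(t)\mathcal MU(t)^*=\mathcal M$ for every $t\in\mathbb R$. $B$ is a weighted permutation matrix for the permutation $\sigma$ if $|b_{i,\sigma(i)}|=1$ for all $i$ (so $b_{i,j}=0$ for $j\neq\sigma(i)$). $\Omega$ tiles $\mathbb R$ by $\mathcal T$ if $\{\Omega+t:t\in\mathcal T\}$ is a partition of $\mathbb R$ up to measure zero. Two measurable sets $A,A'\subset\mathbb R$ are translation congruent modulo $L\mathbb Z$ if there are at most countable measurable partitions $\{A_i\}_{i\in I}$ of $A$ and $\{A'_i\}_{i\in I}$ of $A'$ and integers $k_i$ with $A_i+k_iL=A'_i$ up to measure zero. *)

theory Defs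
  imports "HOL-Analysis.Analysis" "HOL-Combinatorics.Combinatorics"
begin

section \<open>The Hilbert space of square-integrable functions\<close>

text \<open>
  Elements of the Hilbert space $L^2(M)$ are represented by functions, identified when they agree
  almost everywhere.  An operator is a map on functions; its values matter only on
  representatives of elements of $L^2(M)$, and only up to almost everywhere equality.
\<close>

definition L2 :: "'a measure \<Rightarrow> ('a \<Rightarrow> complex) set" where
  "L2 M = {f. f \<in> borel_measurable M \<and> integrable M (\<lambda>x. (norm (f x))\<^sup>2)}"

definition L2_inner :: "'a measure \<Rightarrow> ('a \<Rightarrow> complex) \<Rightarrow> ('a \<Rightarrow> complex) \<Rightarrow> complex" where
  "L2_inner M f g = (LINT x|M. f x * cnj (g x))"

definition L2_norm :: "'a measure \<Rightarrow> ('a \<Rightarrow> complex) \<Rightarrow> real" where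
  "L2_norm M f = sqrt (LINT x|M. (norm (f x))\<^sup>2)"

text \<open>A linear operator defined on all of $L^2(M)$, well defined on almost everywhere classes.\<close>

definition L2_operator ::
    "'a measure \<Rightarrow> (('a \<Rightarrow> complex) \<Rightarrow> 'a \<Rightarrow> complex) \<Rightarrow> bool" where
  "L2_operator M T \<longleftrightarrow>
     (\<forall>f\<in>L2 M. T f \<in> L2 M) \<and>
     (\<forall>f\<in>L2 M. \<forall>g\<in>L2 M. (AE x in M. f x = g x) \<longrightarrow> (AE x in M. T f x = T g x)) \<and>
     (\<forall>f\<in>L2 M. \<forall>g\<in>L2 M. AE x in M. T (\<lambda>y. f y + g y) x = T f x + T g x) \<and>
     (\<forall>c. \<forall>f\<in>L2 M. AE x in M. T (\<lambda>y. c * f y) x = c * T f x)"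

definition L2_op_eq ::
    "'a measure \<Rightarrow> (('a \<Rightarrow> complex) \<Rightarrow> 'a \<Rightarrow> complex)
       \<Rightarrow> (('a \<Rightarrow> complex) \<Rightarrow> 'a \<Rightarrow> complex) \<Rightarrow> bool" where
  "L2_op_eq M S T \<longleftrightarrow> (\<forall>f\<in>L2 M. AE x in M. S f x = T f x)"

definition L2_unitary ::
    "'a measure \<Rightarrow> (('a \<Rightarrow> complex) \<Rightarrow> 'a \<Rightarrow> complex) \<Rightarrow> bool" where
  "L2_unitary M T \<longleftrightarrow>
     L2_operator M T \<and>
     (\<forall>f\<in>L2 M. \<forall>g\<in>L2 M. L2_inner M (T f) (T g) = L2_inner M f g) \<and>
     (\<forall>g\<in>L2 M. \<exists>f\<in>L2 M. AE x in M. T f x = g x)"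

text \<open>The adjoint of a bounded operator; it is determined up to \<^const>\<open>L2_op_eq\<close>.\<close>

definition L2_adjoint ::
    "'a measure \<Rightarrow> (('a \<Rightarrow> complex) \<Rightarrow> 'a \<Rightarrow> complex)
       \<Rightarrow> ('a \<Rightarrow> complex) \<Rightarrow> 'a \<Rightarrow> complex" where
  "L2_adjoint M T =
     (SOME S. L2_operator M S \<and>
              (\<forall>f\<in>L2 M. \<forall>g\<in>L2 M. L2_inner M (T f) g = L2_inner M f (S g)))"

text \<open>Orthogonal basis: pairwise orthogonal nonzero vectors with dense linear span.\<close>

definition L2_orthogonal_basis :: "'a measure \<Rightarrow> ('a \<Rightarrow> complex) set \<Rightarrow> bool" where
  "L2_orthogonal_basis M E \<longleftrightarrow>
     E \<subseteq> L2 M \<and>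
     (\<forall>f\<in>E. L2_norm M f \<noteq> 0) \<and>
     pairwise (\<lambda>f g. L2_inner M f g = 0) E \<and>
     (\<forall>f\<in>L2 M. \<forall>\<epsilon>>0. \<exists>F c. finite F \<and> F \<subseteq> E \<and>
        L2_norm M (\<lambda>x. f x - (\<Sum>h\<in>F. c h * h x)) < \<epsilon>)"

section \<open>Unitary groups and the Forelli condition\<close>

text \<open>
  \<open>exp_group M A U\<close> says $U(t) = \exp(2\pi\sqrt{-1}\,tA)$ for all real $t$, where the
  unbounded operator $A$ is given by its graph.  In the sense of Stone's theorem, $U$ is the strongly
  continuous one-parameter unitary group whose infinitesimal generator is $2\pi\sqrt{-1}A$:
  $f$ is in the domain of $A$ with $Af = g$ iff $(U(t)f-f)/(2\pi\sqrt{-1}\,t)$ tends to $g$ in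
  $L^2$ as $t$ tends to $0$.
\<close>

definition exp_group ::
    "'a measure \<Rightarrow> (('a \<Rightarrow> complex) \<times> ('a \<Rightarrow> complex)) set
       \<Rightarrow> (real \<Rightarrow> ('a \<Rightarrow> complex) \<Rightarrow> 'a \<Rightarrow> complex) \<Rightarrow> bool" where
  "exp_group M A U \<longleftrightarrow>
     (\<forall>t. L2_unitary M (U t)) \<and>
     L2_op_eq M (U 0) (\<lambda>f. f) \<and>
     (\<forall>s t. L2_op_eq M (U (s + t)) (\<lambda>f. U s (U t f))) \<and>
     (\<forall>f\<in>L2 M. \<forall>s. ((\<lambda>t. L2_norm M (\<lambda>x. U t f x - U s f x)) \<longlongrightarrow> 0) (at s)) \<and>
     (\<forall>f\<in>L2 M. \<forall>g\<in>L2 M.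
        (f, g) \<in> A \<longleftrightarrow>
        ((\<lambda>t. L2_norm M (\<lambda>x. (U t f x - f x) / (2 * of_real pi * \<i> * of_real t) - g x))
           \<longlongrightarrow> 0) (at 0))"

definition Linf :: "'a measure \<Rightarrow> ('a \<Rightarrow> complex) set" where
  "Linf M = {g. g \<in> borel_measurable M \<and> (\<exists>C. AE x in M. norm (g x) \<le> C)}"

definition mult_op :: "('a \<Rightarrow> complex) \<Rightarrow> ('a \<Rightarrow> complex) \<Rightarrow> 'a \<Rightarrow> complex" where
  "mult_op g f = (\<lambda>x. g x * f x)"

text \<open>
  The set of all multiplication operators, as a set of operators closed under
  \<^const>\<open>L2_op_eq\<close>; so is the conjugated set below, which makes the set equality in
  \<open>forelli\<close> an equality of sets of operators on $L^2(M)$.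
\<close>

definition mult_algebra :: "'a measure \<Rightarrow> (('a \<Rightarrow> complex) \<Rightarrow> 'a \<Rightarrow> complex) set" where
  "mult_algebra M = {T. \<exists>g\<in>Linf M. L2_op_eq M T (mult_op g)}"

definition conjugated ::
    "'a measure \<Rightarrow> (('a \<Rightarrow> complex) \<Rightarrow> 'a \<Rightarrow> complex)
       \<Rightarrow> (('a \<Rightarrow> complex) \<Rightarrow> 'a \<Rightarrow> complex) set
       \<Rightarrow> (('a \<Rightarrow> complex) \<Rightarrow> 'a \<Rightarrow> complex) set" where
  "conjugated M V \<T> = {S. \<exists>T\<in>\<T>. L2_op_eq M S (\<lambda>f. V (T (L2_adjoint M V f)))}"

definition forelli ::
    "'a measure \<Rightarrow> (real \<Rightarrow> ('a \<Rightarrow> complex) \<Rightarrow> 'a \<Rightarrow> complex) \<Rightarrow> bool" where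
  "forelli M U \<longleftrightarrow> (\<forall>t. conjugated M (U t) (mult_algebra M) = mult_algebra M)"

section \<open>Finite unions of intervals and the differential operator\<close>

text \<open>
  The index type \<open>'n\<close> plays the role of $\{1,\dots,n\}$ with its usual order, so
  $n$ is \<open>CARD('n)\<close> and the index $1$ is \<open>Min UNIV\<close>.
\<close>

definition ordered_intervals ::
    "real ^ ('n :: {finite, linorder}) \<Rightarrow> real ^ ('n :: {finite, linorder}) \<Rightarrow> bool" where
  "ordered_intervals \<alpha> \<beta> \<longleftrightarrow>
     (\<forall>i. \<alpha> $ i < \<beta> $ i) \<and> (\<forall>i j. i < j \<longrightarrow> \<beta> $ i < \<alpha> $ j)"

definition Omega :: "real ^ 'n \<Rightarrow> real ^ 'n \<Rightarrow> real set" where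
  "Omega \<alpha> \<beta> = (\<Union>i. {\<alpha> $ i <..< \<beta> $ i})"

definition absolutely_continuous_on :: "real set \<Rightarrow> (real \<Rightarrow> complex) \<Rightarrow> bool" where
  "absolutely_continuous_on S f \<longleftrightarrow>
     (\<forall>\<epsilon>>0. \<exists>\<delta>>0. \<forall>N a b.
        (\<forall>k<N. a k \<le> b k \<and> {a k..b k} \<subseteq> S) \<longrightarrow>
        disjoint_family_on (\<lambda>k. {a k<..<b k}) {..<N} \<longrightarrow>
        (\<Sum>k<(N::nat). b k - a k) < \<delta> \<longrightarrow>
        (\<Sum>k<N. norm (f (b k) - f (a k))) < \<epsilon>)"

definition trace_left :: "real ^ 'n \<Rightarrow> (real \<Rightarrow> complex) \<Rightarrow> complex ^ 'n" where
  "trace_left \<alpha> f = (\<chi> i. Lim (at_right (\<alpha> $ i)) f)"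

definition trace_right :: "real ^ 'n \<Rightarrow> (real \<Rightarrow> complex) \<Rightarrow> complex ^ 'n" where
  "trace_right \<beta> f = (\<chi> i. Lim (at_left (\<beta> $ i)) f)"

text \<open>
  An absolutely continuous function is differentiable almost everywhere, and on the exceptional
  null set the value of \<^const>\<open>vector_derivative\<close> is irrelevant.
\<close>

definition dom_max :: "real ^ 'n \<Rightarrow> real ^ 'n \<Rightarrow> (real \<Rightarrow> complex) set" where
  "dom_max \<alpha> \<beta> =
     {f \<in> L2 (lebesgue_on (Omega \<alpha> \<beta>)).
        (\<forall>i. absolutely_continuous_on {\<alpha> $ i <..< \<beta> $ i} f) \<and>
        (\<lambda>x. vector_derivative f (at x)) \<in> L2 (lebesgue_on (Omega \<alpha> \<beta>))}"

definition dom_B ::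
    "real ^ 'n \<Rightarrow> real ^ 'n \<Rightarrow> complex ^ 'n ^ 'n \<Rightarrow> (real \<Rightarrow> complex) set" where
  "dom_B \<alpha> \<beta> B = {f \<in> dom_max \<alpha> \<beta>. B *v trace_left \<alpha> f = trace_right \<beta> f}"

text \<open>The graph of $D_B$, as a relation compatible with almost everywhere equality.\<close>

definition D_op ::
    "real ^ 'n \<Rightarrow> real ^ 'n \<Rightarrow> complex ^ 'n ^ 'n
       \<Rightarrow> ((real \<Rightarrow> complex) \<times> (real \<Rightarrow> complex)) set" where
  "D_op \<alpha> \<beta> B =
     {(f, g). f \<in> L2 (lebesgue_on (Omega \<alpha> \<beta>)) \<and> g \<in> L2 (lebesgue_on (Omega \<alpha> \<beta>)) \<and>
        (\<exists>h\<in>dom_B \<alpha> \<beta> B.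
           (AE x in lebesgue_on (Omega \<alpha> \<beta>). f x = h x) \<and>
           (AE x in lebesgue_on (Omega \<alpha> \<beta>).
              g x = 1 / (2 * of_real pi * \<i>) * vector_derivative h (at x)))}"

section \<open>Spectral sets and boundary matrices\<close>

definition e_fun :: "real \<Rightarrow> real \<Rightarrow> complex" where
  "e_fun \<mu> x = exp (2 * of_real pi * \<i> * of_real \<mu> * of_real x)"

definition spectrum_of :: "real set \<Rightarrow> real set \<Rightarrow> bool" where
  "spectrum_of \<Omega> \<Lambda> \<longleftrightarrow> L2_orthogonal_basis (lebesgue_on \<Omega>) (e_fun ` \<Lambda>)"

definition unitary_matrix :: "complex ^ 'n ^ 'n \<Rightarrow> bool" where
  "unitary_matrix B \<longleftrightarrow>
     B ** transpose (map_matrix cnj B) = mat 1 \<and> transpose (map_matrix cnj B) ** B = mat 1"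

definition boundary_matrix ::
    "real ^ 'n \<Rightarrow> real ^ 'n \<Rightarrow> real set \<Rightarrow> complex ^ 'n ^ 'n \<Rightarrow> bool" where
  "boundary_matrix \<alpha> \<beta> \<Lambda> B \<longleftrightarrow>
     unitary_matrix B \<and>
     (\<forall>\<mu>\<in>\<Lambda>. B *v trace_left \<alpha> (e_fun \<mu>) = trace_right \<beta> (e_fun \<mu>))"

definition weighted_permutation_matrix :: "complex ^ 'n ^ 'n \<Rightarrow> ('n \<Rightarrow> 'n) \<Rightarrow> bool" where
  "weighted_permutation_matrix B \<sigma> \<longleftrightarrow>
     (\<forall>i. norm (B $ i $ \<sigma> i) = 1) \<and> (\<forall>i j. j \<noteq> \<sigma> i \<longrightarrow> B $ i $ j = 0)"

section \<open>Tilings and translation congruence\<close>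

definition tiles :: "real set \<Rightarrow> real set \<Rightarrow> bool" where
  "tiles \<Omega> \<T> \<longleftrightarrow>
     negligible (UNIV - (\<Union>t\<in>\<T>. (+) t ` \<Omega>)) \<and>
     (\<forall>s\<in>\<T>. \<forall>t\<in>\<T>. s \<noteq> t \<longrightarrow> negligible ((+) s ` \<Omega> \<inter> (+) t ` \<Omega>))"

definition measurable_partition :: "nat set \<Rightarrow> (nat \<Rightarrow> real set) \<Rightarrow> real set \<Rightarrow> bool" where
  "measurable_partition I P A \<longleftrightarrow>
     (\<forall>i\<in>I. P i \<in> sets lebesgue) \<and> disjoint_family_on P I \<and> (\<Union>i\<in>I. P i) = A"

text \<open>
  The pieces \<open>P i\<close> of \<open>A\<close>, the pieces \<open>P' i\<close> of \<open>A'\<close> and the integers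
  \<open>k i\<close> realise the translation congruence of \<open>A\<close> and \<open>A'\<close> modulo the multiples of
  \<open>L\<close>.
\<close>

definition translation_congruence ::
    "real \<Rightarrow> real set \<Rightarrow> real set \<Rightarrow> nat set \<Rightarrow> (nat \<Rightarrow> real set) \<Rightarrow> (nat \<Rightarrow> real set)
       \<Rightarrow> (nat \<Rightarrow> int) \<Rightarrow> bool" where
  "translation_congruence L A A' I P P' k \<longleftrightarrow>
     measurable_partition I P A \<and> measurable_partition I P' A' \<and>
     (\<forall>i\<in>I. negligible (sym_diff ((+) (of_int (k i) * L) ` P i) (P' i)))"

definition translation_congruent :: "real \<Rightarrow> real set \<Rightarrow> real set \<Rightarrow> bool" where
  "translation_congruent L A A' \<longleftrightarrow> (\<exists>I P P' k. translation_congruence L A A' I P P' k)"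

text \<open>
  \<open>itinerary \<sigma> k\<close> is $\sigma^k(1)$, and \<open>cycle_shift \<alpha> \<beta> \<sigma> k\<close> is
  $\tau_k$, with $\tau_0 = 0$.
\<close>

definition itinerary :: "(('n :: {finite, linorder}) \<Rightarrow> ('n :: {finite, linorder})) \<Rightarrow> nat \<Rightarrow> ('n :: {finite, linorder})" where
  "itinerary \<sigma> k = (\<sigma> ^^ k) (Min UNIV)"

definition cycle_shift ::
    "real ^ ('n :: {finite, linorder}) \<Rightarrow> real ^ ('n :: {finite, linorder}) \<Rightarrow> (('n :: {finite, linorder}) \<Rightarrow> ('n :: {finite, linorder})) \<Rightarrow> nat \<Rightarrow> real" where
  "cycle_shift \<alpha> \<beta> \<sigma> k =
     (\<Sum>j<k. \<beta> $ itinerary \<sigma> j - \<alpha> $ itinerary \<sigma> (j + 1))"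

end

theory Submission
  imports Defs
begin

text \<open>
  The generator condition forces $U(t)e_\lambda = e^{2\pi\sqrt{-1}\,t\lambda}e_\lambda$, so by density $U(t)$
  acts as translation by $t$ inside each interval, while near $\beta_i$ it reads the values of $f$ just after
  the points $\alpha_j$ with weights $b_{i,j}$.  Conjugating multiplication by the indicator function of a
  single interval by $U(t)$ for small $t$, the Forelli condition leaves at most one nonzero entry in each
  row of $B$.

  For a weighted permutation matrix, the inner product of $e_\lambda$, $\lambda\in\Lambda$, with a piecewise
  exponential $\sum_i c_i e_\nu 1_{(\alpha_i,\beta_i)}$ satisfying the boundary condition telescopes
  to $0$ unless $\nu = \lambda$.  By completeness such a function vanishes when $\nu\notin\Lambda$, or when
  $\nu\in\Lambda$ and $\sum_i c_i l_i = 0$.  With $c$ the centred indicator of a $\sigma$-invariant set this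
  shows that $\sigma$ is an $n$-cycle; with $c_{\sigma^k(1)} = e^{2\pi\sqrt{-1}(\nu-\mu)\tau_k}$, $\mu\in\Lambda$, it shows that
  $\Lambda$ contains $\mu + \frac1L\mathbb{Z}$.  Comparing $b_{i,\sigma(i)}$ for the frequencies
  $\mu$ and $\mu + \frac1L$ puts the gaps $\alpha_{\sigma(i)}-\beta_i$ in $L\mathbb{Z}$.
\<close>

section \<open>Square-integrable functions\<close>

lemma borel_measurable_cnj [measurable (raw)]:
  "f \<in> borel_measurable M \<Longrightarrow> (\<lambda>x. cnj (f x)) \<in> borel_measurable M"
  by (rule measurable_compose[OF _ borel_measurable_continuous_onI[OF continuous_on_cnj[OF continuous_on_id]]])

lemma L2_measurable: "f \<in> L2 M \<Longrightarrow> f \<in> borel_measurable M"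
  by (simp add: L2_def)

lemma L2_integrable_sq: "f \<in> L2 M \<Longrightarrow> integrable M (\<lambda>x. (norm (f x))\<^sup>2)"
  by (simp add: L2_def)

text \<open>This quadratic form of the triangle inequality passes to integrals directly. The factor
  2 does no harm, since the estimates built on it end in a limit equal to zero.\<close>

lemma norm_add_sq_le: "(norm (a + b))\<^sup>2 \<le> 2 * (norm a)\<^sup>2 + 2 * (norm (b::complex))\<^sup>2"
proof -
  have "(norm (a + b))\<^sup>2 \<le> (norm a + norm b)\<^sup>2"
    by (intro power_mono norm_triangle_ineq) auto
  also have "\<dots> \<le> 2 * (norm a)\<^sup>2 + 2 * (norm b)\<^sup>2"
    using sum_squares_bound[of "norm a" "norm b"] by (simp add: power2_sum)
  finally show ?thesis .
qed

lemma L2_add: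
  assumes "f \<in> L2 M" "g \<in> L2 M" shows "(\<lambda>x. f x + g x) \<in> L2 M"
proof -
  note [measurable] = L2_measurable[OF assms(1)] L2_measurable[OF assms(2)]
  have "integrable M (\<lambda>x. (norm (f x + g x))\<^sup>2)"
  proof (rule Bochner_Integration.integrable_bound)
    show "integrable M (\<lambda>x. 2 * (norm (f x))\<^sup>2 + 2 * (norm (g x))\<^sup>2)"
      using assms by (simp add: L2_def)
  qed (use norm_add_sq_le in auto)
  then show ?thesis by (simp add: L2_def)
qed

lemma L2_scale:
  assumes "f \<in> L2 M" shows "(\<lambda>x. c * f x) \<in> L2 M"
  using assms by (auto simp: L2_def norm_mult power_mult_distrib)

lemma L2_diff:
  assumes "f \<in> L2 M" "g \<in> L2 M" shows "(\<lambda>x. f x - g x) \<in> L2 M"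
  using L2_add[OF assms(1) L2_scale[OF assms(2), of "-1"]] by simp

lemma L2_zero: "(\<lambda>x. 0) \<in> L2 M"
  by (simp add: L2_def)

lemma L2_sum:
  assumes "finite F" "\<And>h. h \<in> F \<Longrightarrow> f h \<in> L2 M"
  shows "(\<lambda>x. \<Sum>h\<in>F. f h x) \<in> L2 M"
  using assms by (induction F) (auto simp: L2_zero L2_add)

lemma L2_mult_Linf:
  assumes "g \<in> Linf M" "f \<in> L2 M" shows "(\<lambda>x. g x * f x) \<in> L2 M"
proof -
  obtain C where C: "AE x in M. norm (g x) \<le> C" and [measurable]: "g \<in> borel_measurable M"
    using assms(1) by (auto simp: Linf_def)
  note [measurable] = L2_measurable[OF assms(2)]
  have "integrable M (\<lambda>x. (norm (g x * f x))\<^sup>2)"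
  proof (rule Bochner_Integration.integrable_bound)
    show "integrable M (\<lambda>x. C\<^sup>2 * (norm (f x))\<^sup>2)"
      using assms by (simp add: L2_def)
    show "AE x in M. norm ((norm (g x * f x))\<^sup>2) \<le> norm (C\<^sup>2 * (norm (f x))\<^sup>2)"
      using C
    proof eventually_elim
      case (elim x)
      then have "(norm (g x))\<^sup>2 \<le> C\<^sup>2" by (intro power_mono) auto
      then show ?case by (simp add: norm_mult power_mult_distrib mult_right_mono)
    qed
  qed simp
  then show ?thesis by (simp add: L2_def)
qed

lemma L2_inner_integrable:
  assumes "f \<in> L2 M" "g \<in> L2 M" shows "integrable M (\<lambda>x. f x * cnj (g x))"
proof (rule Bochner_Integration.integrable_bound)
  note [measurable] = L2_measurable[OF assms(1)] L2_measurable[OF assms(2)]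
  show "integrable M (\<lambda>x. (norm (f x))\<^sup>2 + (norm (g x))\<^sup>2)"
    using assms by (simp add: L2_def)
  show "AE x in M. norm (f x * cnj (g x)) \<le> norm ((norm (f x))\<^sup>2 + (norm (g x))\<^sup>2)"
  proof (rule AE_I2)
    fix x
    have "2 * (norm (f x) * norm (g x)) \<le> (norm (f x))\<^sup>2 + (norm (g x))\<^sup>2"
      using sum_squares_bound[of "norm (f x)" "norm (g x)"] by simp
    moreover have "0 \<le> norm (f x * cnj (g x))" by (rule norm_ge_zero)
    moreover have "norm (f x * cnj (g x)) = norm (f x) * norm (g x)" by (simp add: norm_mult)
    ultimately show "norm (f x * cnj (g x)) \<le> norm ((norm (f x))\<^sup>2 + (norm (g x))\<^sup>2)"
      unfolding real_norm_def by linarith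
  qed
  show "(\<lambda>x. f x * cnj (g x)) \<in> borel_measurable M" by measurable
qed

lemma L2_inner_diff_left:
  assumes "f \<in> L2 M" "g \<in> L2 M" "h \<in> L2 M"
  shows "L2_inner M (\<lambda>x. f x - g x) h = L2_inner M f h - L2_inner M g h"
  unfolding L2_inner_def left_diff_distrib
  using assms by (intro Bochner_Integration.integral_diff L2_inner_integrable)

lemma L2_inner_diff_right:
  assumes "f \<in> L2 M" "g \<in> L2 M" "h \<in> L2 M"
  shows "L2_inner M h (\<lambda>x. f x - g x) = L2_inner M h f - L2_inner M h g"
  unfolding L2_inner_def complex_cnj_diff right_diff_distrib
  using assms by (intro Bochner_Integration.integral_diff L2_inner_integrable)

lemma L2_inner_sum_right:
  assumes "g \<in> L2 M" "finite F" "\<And>h. h \<in> F \<Longrightarrow> h \<in> L2 M"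
  shows "L2_inner M g (\<lambda>x. \<Sum>h\<in>F. c h * h x) = (\<Sum>h\<in>F. cnj (c h) * L2_inner M g h)"
proof -
  have "L2_inner M g (\<lambda>x. \<Sum>h\<in>F. c h * h x)
      = (LINT x|M. (\<Sum>h\<in>F. cnj (c h) * (g x * cnj (h x))))"
    unfolding L2_inner_def cnj_sum sum_distrib_left complex_cnj_mult
    by (intro Bochner_Integration.integral_cong sum.cong refl) simp
  also have "\<dots> = (\<Sum>h\<in>F. LINT x|M. cnj (c h) * (g x * cnj (h x)))"
    using assms by (intro Bochner_Integration.integral_sum Bochner_Integration.integrable_mult_right
        L2_inner_integrable) auto
  finally show ?thesis by (simp add: L2_inner_def)
qed

lemma L2_inner_cong_AE:
  assumes "f \<in> L2 M" "f' \<in> L2 M" "g \<in> L2 M" "g' \<in> L2 M"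
    and "AE x in M. f x = f' x" "AE x in M. g x = g' x"
  shows "L2_inner M f g = L2_inner M f' g'"
proof -
  note [measurable] = assms(1-4)[THEN L2_measurable]
  show ?thesis
    unfolding L2_inner_def
  proof (rule integral_cong_AE)
    show "AE x in M. f x * cnj (g x) = f' x * cnj (g' x)"
      using assms(5,6) by eventually_elim simp
  qed measurable
qed

lemma L2_norm_sq: "(L2_norm M f)\<^sup>2 = (LINT x|M. (norm (f x))\<^sup>2)"
  by (simp add: L2_norm_def)

lemma L2_norm_nonneg: "0 \<le> L2_norm M f"
  by (simp add: L2_norm_def)

lemma L2_norm_cong_AE:
  assumes "f \<in> L2 M" "g \<in> L2 M" "AE x in M. f x = g x"
  shows "L2_norm M f = L2_norm M g"
proof -
  note [measurable] = assms(1,2)[THEN L2_measurable]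
  show ?thesis
    unfolding L2_norm_def using assms(3) by (intro arg_cong[of _ _ sqrt] integral_cong_AE) auto
qed

lemma L2_inner_self: "L2_inner M f f = of_real ((L2_norm M f)\<^sup>2)"
  unfolding L2_norm_sq L2_inner_def
  by (simp add: complex_norm_square[symmetric] flip: of_real_power)

lemma L2_norm_scale: "L2_norm M (\<lambda>x. c * f x) = norm c * L2_norm M f"
  by (simp add: L2_norm_def norm_mult power_mult_distrib real_sqrt_mult)

lemma L2_norm_add_sq_le:
  assumes "f \<in> L2 M" "g \<in> L2 M"
  shows "(L2_norm M (\<lambda>x. f x + g x))\<^sup>2 \<le> 2 * (L2_norm M f)\<^sup>2 + 2 * (L2_norm M g)\<^sup>2"
proof -
  have "(LINT x|M. (norm (f x + g x))\<^sup>2) \<le> (LINT x|M. 2 * (norm (f x))\<^sup>2 + 2 * (norm (g x))\<^sup>2)"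
    using assms L2_add[OF assms] by (intro integral_mono norm_add_sq_le) (auto simp: L2_def)
  also have "\<dots> = 2 * (LINT x|M. (norm (f x))\<^sup>2) + 2 * (LINT x|M. (norm (g x))\<^sup>2)"
    using assms by (subst Bochner_Integration.integral_add) (auto simp: L2_def)
  finally show ?thesis by (simp add: L2_norm_sq)
qed

lemma L2_norm_eq_0_iff:
  assumes "f \<in> L2 M" shows "L2_norm M f = 0 \<longleftrightarrow> (AE x in M. f x = 0)"
  using integral_nonneg_eq_0_iff_AE[OF L2_integrable_sq[OF assms]] by (simp add: L2_norm_def)

text \<open>If \<open>g\<close> is orthogonal to \<open>E\<close>, it is orthogonal to every
  approximant \<open>p\<close> from the span, so Pythagoras gives \<open>L2_norm M g\<close> at most
  \<open>L2_norm M (g - p)\<close>. Density makes the latter arbitrarily small.\<close>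

lemma L2_orthogonal_basis_complete:
  assumes basis: "L2_orthogonal_basis M E" and g: "g \<in> L2 M"
    and perp: "\<And>h. h \<in> E \<Longrightarrow> L2_inner M g h = 0"
  shows "AE x in M. g x = 0"
proof -
  have small: "L2_norm M g < \<epsilon>" if "\<epsilon> > 0" for \<epsilon>
  proof -
    obtain F c where F: "finite F" "F \<subseteq> E"
      and lt: "L2_norm M (\<lambda>x. g x - (\<Sum>h\<in>F. c h * h x)) < \<epsilon>"
      using basis g \<open>\<epsilon> > 0\<close> unfolding L2_orthogonal_basis_def by blast
    define p where "p = (\<lambda>x. \<Sum>h\<in>F. c h * h x)"
    have E: "h \<in> L2 M" if "h \<in> F" for h
      using basis F that by (auto simp: L2_orthogonal_basis_def)
    have p: "p \<in> L2 M"
      unfolding p_def using F E by (intro L2_sum L2_scale)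
    have gp: "L2_inner M g p = 0"
      unfolding p_def using F E perp g by (subst L2_inner_sum_right) (auto intro!: sum.neutral)
    have "L2_inner M p g = (LINT x|M. cnj (g x * cnj (p x)))"
      by (simp add: L2_inner_def mult.commute)
    also have "\<dots> = cnj (L2_inner M g p)"
      unfolding L2_inner_def by (rule Bochner_Integration.integral_cnj)
    finally have "L2_inner M p g = cnj (L2_inner M g p)" .
    then have pg: "L2_inner M p g = 0" using gp by simp
    have "L2_inner M (\<lambda>x. g x - p x) (\<lambda>x. g x - p x) = L2_inner M g g + L2_inner M p p"
      using g p gp pg by (simp add: L2_inner_diff_left L2_inner_diff_right L2_diff)
    then have "(L2_norm M (\<lambda>x. g x - p x))\<^sup>2 = (L2_norm M g)\<^sup>2 + (L2_norm M p)\<^sup>2"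
      unfolding L2_inner_self of_real_add[symmetric] of_real_eq_iff .
    then have "(L2_norm M g)\<^sup>2 \<le> (L2_norm M (\<lambda>x. g x - p x))\<^sup>2"
      by simp
    then have "L2_norm M g \<le> L2_norm M (\<lambda>x. g x - p x)"
      by (rule power2_le_imp_le[OF _ L2_norm_nonneg])
    with lt show ?thesis by (simp add: p_def)
  qed
  have "L2_norm M g \<le> 0"
  proof (rule field_le_epsilon)
    show "L2_norm M g \<le> 0 + e" if "0 < e" for e
      using small[OF that] by simp
  qed
  then show ?thesis
    using L2_norm_eq_0_iff[OF g] L2_norm_nonneg[of M g] by simp
qed

section \<open>Unitary groups\<close>

lemma L2_unitary_mem: "L2_unitary M V \<Longrightarrow> f \<in> L2 M \<Longrightarrow> V f \<in> L2 M"
  by (simp add: L2_unitary_def L2_operator_def)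

lemma L2_unitary_cong_AE:
  "L2_unitary M V \<Longrightarrow> f \<in> L2 M \<Longrightarrow> g \<in> L2 M \<Longrightarrow> AE x in M. f x = g x \<Longrightarrow> AE x in M. V f x = V g x"
  by (simp add: L2_unitary_def L2_operator_def)

lemma L2_unitary_add:
  "L2_unitary M V \<Longrightarrow> f \<in> L2 M \<Longrightarrow> g \<in> L2 M \<Longrightarrow> AE x in M. V (\<lambda>y. f y + g y) x = V f x + V g x"
  by (simp add: L2_unitary_def L2_operator_def)

lemma L2_unitary_scale:
  "L2_unitary M V \<Longrightarrow> f \<in> L2 M \<Longrightarrow> AE x in M. V (\<lambda>y. c * f y) x = c * V f x"
  by (simp add: L2_unitary_def L2_operator_def)

lemma L2_unitary_norm:
  assumes "L2_unitary M V" "f \<in> L2 M" shows "L2_norm M (V f) = L2_norm M f"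
proof -
  have "complex_of_real ((L2_norm M (V f))\<^sup>2) = of_real ((L2_norm M f)\<^sup>2)"
    using assms unfolding L2_inner_self[symmetric] by (simp add: L2_unitary_def)
  then have "(L2_norm M (V f))\<^sup>2 = (L2_norm M f)\<^sup>2"
    by (simp only: of_real_eq_iff)
  then show ?thesis by (simp add: L2_norm_nonneg)
qed

lemma L2_unitary_zero:
  assumes "L2_unitary M V" shows "AE x in M. V (\<lambda>y. 0) x = 0"
  using L2_unitary_scale[OF assms L2_zero, of 0] by simp

lemma L2_unitary_diff:
  assumes "L2_unitary M V" "f \<in> L2 M" "g \<in> L2 M"
  shows "AE x in M. V (\<lambda>y. f y - g y) x = V f x - V g x"
  using L2_unitary_add[OF assms(1,2) L2_scale[OF assms(3), of "-1"]]
    L2_unitary_scale[OF assms(1,3), of "-1"]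
  by eventually_elim simp

lemma L2_unitary_sum:
  assumes V: "L2_unitary M V" and F: "finite F" "\<And>h. h \<in> F \<Longrightarrow> h \<in> L2 M"
  shows "AE x in M. V (\<lambda>y. \<Sum>h\<in>F. c h * h y) x = (\<Sum>h\<in>F. c h * V h x)"
  using F
proof (induction F rule: finite_induct)
  case empty
  then show ?case using L2_unitary_zero[OF V] by simp
next
  case (insert k F)
  have "AE x in M. V (\<lambda>y. c k * k y + (\<Sum>h\<in>F. c h * h y)) x
      = V (\<lambda>y. c k * k y) x + V (\<lambda>y. \<Sum>h\<in>F. c h * h y) x"
    using insert by (intro L2_unitary_add[OF V] L2_scale L2_sum) auto
  moreover have "AE x in M. V (\<lambda>y. c k * k y) x = c k * V k x"
    using insert by (intro L2_unitary_scale[OF V]) auto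
  moreover have "AE x in M. V (\<lambda>y. \<Sum>h\<in>F. c h * h y) x = (\<Sum>h\<in>F. c h * V h x)"
    using insert by auto
  ultimately show ?case
    by eventually_elim (use insert in simp)
qed

lemma exp_group_unitary: "exp_group M A U \<Longrightarrow> L2_unitary M (U t)"
  by (simp add: exp_group_def)

lemma exp_group_add:
  "exp_group M A U \<Longrightarrow> f \<in> L2 M \<Longrightarrow> AE x in M. U (s + t) f x = U s (U t f) x"
  by (simp add: exp_group_def L2_op_eq_def)

lemma exp_group_0: "exp_group M A U \<Longrightarrow> f \<in> L2 M \<Longrightarrow> AE x in M. U 0 f x = f x"
  by (simp add: exp_group_def L2_op_eq_def)

text \<open>\<open>L2_adjoint\<close> is a choice, so existence comes first: U(-t) is an adjoint,
  because g = U(t)U(-t)g and U(t) preserves inner products. For the chosen \<open>S\<close>, the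
  difference \<open>d\<close> of S(U(t)f) and f has inner product 0 with itself, again by
  isometry.\<close>

lemma exp_group_adjoint:
  assumes U: "exp_group M A U" and f: "f \<in> L2 M"
  shows "L2_adjoint M (U t) (U t f) \<in> L2 M"
    and "AE x in M. L2_adjoint M (U t) (U t f) x = f x"
proof -
  define S where "S = L2_adjoint M (U t)"
  note u = exp_group_unitary[OF U]
  have "L2_operator M (U (-t)) \<and>
      (\<forall>f\<in>L2 M. \<forall>g\<in>L2 M. L2_inner M (U t f) g = L2_inner M f (U (-t) g))"
  proof (intro conjI ballI)
    show "L2_operator M (U (-t))" using u by (simp add: L2_unitary_def)
    fix f g assume fg: "f \<in> L2 M" "g \<in> L2 M"
    have 1: "AE x in M. g x = U t (U (-t) g) x"
      using exp_group_add[OF U fg(2), of t "-t"] exp_group_0[OF U fg(2)]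
      by (auto elim: eventually_elim2)
    have "L2_inner M (U t f) g = L2_inner M (U t f) (U t (U (-t) g))"
      using fg 1 by (intro L2_inner_cong_AE L2_unitary_mem[OF u]) auto
    also have "\<dots> = L2_inner M f (U (-t) g)"
      using fg u[of t] L2_unitary_mem[OF u fg(2)] by (simp add: L2_unitary_def)
    finally show "L2_inner M (U t f) g = L2_inner M f (U (-t) g)" .
  qed
  then have "\<exists>S. L2_operator M S \<and>
      (\<forall>f\<in>L2 M. \<forall>g\<in>L2 M. L2_inner M (U t f) g = L2_inner M f (S g))" by blast
  from someI_ex[OF this] have S: "L2_operator M S \<and>
      (\<forall>f\<in>L2 M. \<forall>g\<in>L2 M. L2_inner M (U t f) g = L2_inner M f (S g))"
    unfolding S_def L2_adjoint_def .
  have Uf: "U t f \<in> L2 M" by (rule L2_unitary_mem[OF u f])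
  show SUf: "L2_adjoint M (U t) (U t f) \<in> L2 M"
    using S Uf by (simp add: L2_operator_def S_def)
  define d where "d = (\<lambda>x. S (U t f) x - f x)"
  have d: "d \<in> L2 M"
    unfolding d_def using SUf f by (intro L2_diff) (auto simp: S_def)
  have "L2_inner M d (\<lambda>x. S (U t f) x - f x) = L2_inner M d (S (U t f)) - L2_inner M d f"
    using SUf f d by (intro L2_inner_diff_right) (auto simp: S_def)
  also have "L2_inner M d (S (U t f)) = L2_inner M (U t d) (U t f)"
    using S d Uf by simp
  also have "\<dots> = L2_inner M d f"
    using u[of t] d f by (simp add: L2_unitary_def)
  finally have "L2_inner M d d = 0" by (simp add: d_def)
  then have "AE x in M. d x = 0"
    using L2_norm_eq_0_iff[OF d] by (simp add: L2_inner_self)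
  then show "AE x in M. L2_adjoint M (U t) (U t f) x = f x"
    by (simp add: d_def S_def)
qed

text \<open>The Forelli condition turns U(t) M_g U(t)* into some M_h; evaluating at U(t)f cancels
  the adjoint. The function \<open>h\<close> depends on \<open>t\<close> and \<open>g\<close>, but
  serves all \<open>f\<close> at once.\<close>

lemma forelli_intertwine:
  assumes U: "exp_group M A U" and "forelli M U" and g: "g \<in> Linf M"
  obtains h where "\<And>f. f \<in> L2 M \<Longrightarrow> AE x in M. U t (\<lambda>y. g y * f y) x = h x * U t f x"
proof -
  note u = exp_group_unitary[OF U]
  define S where "S = (\<lambda>f. U t (mult_op g (L2_adjoint M (U t) f)))"
  have "mult_op g \<in> mult_algebra M"
    using g by (auto simp: mult_algebra_def L2_op_eq_def)
  then have "S \<in> conjugated M (U t) (mult_algebra M)"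
    by (auto simp: conjugated_def S_def L2_op_eq_def)
  then have "S \<in> mult_algebra M"
    using \<open>forelli M U\<close> by (simp add: forelli_def)
  then obtain h where h: "\<And>f. f \<in> L2 M \<Longrightarrow> AE x in M. S f x = h x * f x"
    unfolding mult_algebra_def L2_op_eq_def mult_op_def by blast
  have "AE x in M. U t (\<lambda>y. g y * f y) x = h x * U t f x" if f: "f \<in> L2 M" for f
  proof -
    have "AE x in M. U t (\<lambda>y. g y * L2_adjoint M (U t) (U t f) y) x = U t (\<lambda>y. g y * f y) x"
      using exp_group_adjoint[OF U f, of t] f
      by (intro L2_unitary_cong_AE[OF u] L2_mult_Linf[OF g]) (auto elim: eventually_mono)
    then show ?thesis
      using h[OF L2_unitary_mem[OF u f, of t]]
      by eventually_elim (simp add: S_def mult_op_def)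
  qed
  then show ?thesis by (rule that)
qed

section \<open>Eigenvectors of the generator\<close>

text \<open>With w = 2 pi i l, the quotient (exp(wh) - 1)/h tends to the derivative w, and w/(2 pi
  i) = l. This is the scalar part of the defect in \<open>exp_group_eigenvector\<close>.\<close>

lemma exp_diff_quotient_tendsto:
  "((\<lambda>h. of_real l - (exp (2 * of_real pi * \<i> * of_real l * of_real h) - 1)
      / (2 * of_real pi * \<i> * of_real h)) \<longlongrightarrow> (0::complex)) (at (0::real))"
proof -
  define w where "w = 2 * of_real pi * \<i> * (of_real l :: complex)"
  have "((\<lambda>z. exp (w * z)) has_field_derivative w * exp (w * 0)) (at 0)"
    by (auto intro!: derivative_eq_intros)
  then have "((\<lambda>h. (exp (w * h) - 1) / h) \<longlongrightarrow> w) (at 0)"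
    by (simp add: has_field_derivative_iff)
  moreover have "filterlim complex_of_real (at 0) (at 0)"
    by (rule filterlim_atI) (auto intro!: tendsto_eq_intros simp: eventually_at_filter)
  ultimately have "((\<lambda>h::real. (exp (w * of_real h) - 1) / of_real h) \<longlongrightarrow> w) (at 0)"
    by (rule filterlim_compose)
  then have "((\<lambda>h::real. of_real l - (exp (w * of_real h) - 1) / of_real h / (2 * of_real pi * \<i>))
      \<longlongrightarrow> of_real l - w / (2 * of_real pi * \<i>)) (at 0)"
    by (intro tendsto_intros) auto
  then show ?thesis by (simp add: w_def mult_ac)
qed

lemma exp_group_generator:
  assumes "exp_group M A U" "f \<in> L2 M" "g \<in> L2 M" "(f, g) \<in> A"
  shows "((\<lambda>t. L2_norm M (\<lambda>x. (U t f x - f x) / (2 * of_real pi * \<i> * of_real t) - g x))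
           \<longlongrightarrow> 0) (at 0)"
  using assms by (simp add: exp_group_def)

text \<open>The defect of \<open>f\<close> being an eigenvector at time \<open>t\<close> at most doubles with \<open>t\<close>, whereas
  the generator condition makes it \<open>o(t)\<close>; halving \<open>t\<close> repeatedly shows that it vanishes.\<close>

lemma exp_group_eigenvector:
  assumes U: "exp_group M A U" and f: "f \<in> L2 M"
    and ev: "(f, \<lambda>x. of_real l * f x) \<in> A"
  shows "AE x in M. U t f x = exp (2 * of_real pi * \<i> * of_real l * of_real t) * f x"
proof -
  note u = exp_group_unitary[OF U]
  define e where "e t = exp (2 * of_real pi * \<i> * of_real l * of_real t)" for t :: real
  have norm_e: "norm (e t) = 1" for t by (simp add: e_def norm_exp_eq_Re)
  have e_add: "e (s + t) = e s * e t" for s t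
    by (simp add: e_def algebra_simps flip: exp_add)
  have e_double: "e (2 * s) = e s * e s" for s
    unfolding mult_2 by (rule e_add)
  define d where "d t = (\<lambda>x. U t f x - e t * f x)" for t
  have d: "d t \<in> L2 M" for t
    unfolding d_def by (intro L2_diff L2_scale f L2_unitary_mem[OF u])
  define \<psi> where "\<psi> t = (L2_norm M (d t))\<^sup>2" for t
  \<comment> \<open>\<open>\<psi>\<close> is a squared norm, so doubling becomes a factor 4. The
    identity behind it is d(2s) = U(s)d(s) + e(s)d(s), whose two terms both have the norm of
    d(s).\<close>
  have double: "\<psi> (2 * s) \<le> 4 * \<psi> s" for s
  proof -
    have 1: "AE x in M. d (2 * s) x = U s (d s) x + e s * d s x"
      using exp_group_add[OF U f, of s s, folded mult_2]
        L2_unitary_diff[OF u L2_unitary_mem[OF u f] L2_scale[OF f], of s s "e s"]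
        L2_unitary_scale[OF u f, of s "e s"]
    proof eventually_elim
      case (elim x)
      then show ?case
        by (simp add: d_def e_double right_diff_distrib)
    qed
    have "\<psi> (2 * s) = (L2_norm M (\<lambda>x. U s (d s) x + e s * d s x))\<^sup>2"
      unfolding \<psi>_def by (subst L2_norm_cong_AE[OF _ _ 1])
        (auto intro!: L2_add L2_scale d L2_unitary_mem[OF u])
    also have "\<dots> \<le> 2 * (L2_norm M (U s (d s)))\<^sup>2 + 2 * (L2_norm M (\<lambda>x. e s * d s x))\<^sup>2"
      by (intro L2_norm_add_sq_le L2_scale d L2_unitary_mem[OF u])
    also have "\<dots> = 4 * \<psi> s"
      by (simp add: L2_unitary_norm[OF u d] L2_norm_scale norm_e \<psi>_def)
    finally show ?thesis .
  qed
  have dyadic: "\<psi> t \<le> 4 ^ k * \<psi> (t / 2 ^ k)" for k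
  proof (induction k)
    case (Suc k)
    note Suc.IH
    also have "4 ^ k * \<psi> (t / 2 ^ k) \<le> 4 ^ k * (4 * \<psi> (t / 2 ^ Suc k))"
      using double[of "t / 2 ^ Suc k"] by (intro mult_left_mono) auto
    also have "\<dots> = 4 ^ Suc k * \<psi> (t / 2 ^ Suc k)" by simp
    finally show ?case .
  qed simp
  define c where "c h = 2 * of_real pi * \<i> * (of_real h :: complex)" for h :: real
  define r where "r h = (\<lambda>x. (U h f x - f x) / c h - of_real l * f x)" for h
  define \<kappa> where "\<kappa> h = of_real l - (e h - 1) / c h" for h
  have r: "r h \<in> L2 M" for h
  proof -
    have "(\<lambda>x. inverse (c h) * (U h f x - f x) - of_real l * f x) \<in> L2 M"
      by (intro L2_diff L2_scale f L2_unitary_mem[OF u])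
    then show ?thesis by (simp add: r_def divide_inverse mult.commute)
  qed
  have r_lim: "((\<lambda>h. L2_norm M (r h)) \<longlongrightarrow> 0) (at 0)"
    unfolding r_def c_def by (rule exp_group_generator[OF U f L2_scale[OF f] ev])
  have \<kappa>_lim: "(\<kappa> \<longlongrightarrow> 0) (at 0)"
    unfolding \<kappa>_def e_def c_def by (rule exp_diff_quotient_tendsto)
  \<comment> \<open>The defect factors as d(h) = c(h)(r(h) + \<kappa>(h) f), where r(h) is the error
    in the generator condition and \<kappa>(h) the error of the scalar difference quotient. Both
    tend to 0, so \<open>\<psi> h\<close> is o(h^2).\<close>
  have bound: "\<psi> h \<le> 4 * pi\<^sup>2 * h\<^sup>2
      * (2 * (L2_norm M (r h))\<^sup>2 + 2 * (norm (\<kappa> h) * L2_norm M f)\<^sup>2)" if "h \<noteq> 0" for h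
  proof -
    have c0: "c h \<noteq> 0" and normc: "norm (c h) = 2 * pi * \<bar>h\<bar>"
      using that by (auto simp: c_def norm_mult)
    have eq: "d h = (\<lambda>x. c h * (r h x + \<kappa> h * f x))"
      using c0 by (auto simp: d_def r_def \<kappa>_def field_simps fun_eq_iff)
    have "\<psi> h = 4 * pi\<^sup>2 * h\<^sup>2 * (L2_norm M (\<lambda>x. r h x + \<kappa> h * f x))\<^sup>2"
      unfolding \<psi>_def eq L2_norm_scale normc by (simp add: power_mult_distrib)
    also have "\<dots> \<le> 4 * pi\<^sup>2 * h\<^sup>2 * (2 * (L2_norm M (r h))\<^sup>2 + 2 * (L2_norm M (\<lambda>x. \<kappa> h * f x))\<^sup>2)"
      by (intro mult_left_mono L2_norm_add_sq_le r L2_scale f) auto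
    finally show ?thesis by (simp add: L2_norm_scale)
  qed
  have "\<psi> t \<le> 0"
  proof (cases "t = 0")
    case True
    have "L2_norm M (d 0) = 0"
      using exp_group_0[OF U f] by (subst L2_norm_eq_0_iff[OF d]) (simp add: d_def e_def)
    then show ?thesis by (simp add: True \<psi>_def)
  next
    case False
    \<comment> \<open>The preceding bound with t^2 in place of h^2: at h = t/2^k the factor 4^k from
      \<open>dyadic\<close> exactly cancels the 4^k in the denominator of h^2.\<close>
    define G where "G h = 4 * pi\<^sup>2 * t\<^sup>2
      * (2 * (L2_norm M (r h))\<^sup>2 + 2 * (norm (\<kappa> h) * L2_norm M f)\<^sup>2)" for h
    have "(\<lambda>k. t / 2 ^ k) \<longlonglongrightarrow> 0"
      using tendsto_mult[OF tendsto_const LIMSEQ_power_zero[of "1/2::real"], of t]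
      by (simp add: power_divide)
    then have "filterlim (\<lambda>k. t / 2 ^ k) (at 0) sequentially"
      using False by (intro filterlim_atI) auto
    moreover have "(G \<longlongrightarrow> 4 * pi\<^sup>2 * t\<^sup>2 * (2 * 0\<^sup>2 + 2 * (norm (0::complex) * L2_norm M f)\<^sup>2)) (at 0)"
      unfolding G_def by (intro tendsto_intros r_lim \<kappa>_lim)
    ultimately have "(\<lambda>k. G (t / 2 ^ k)) \<longlonglongrightarrow> 0"
      by (auto dest: filterlim_compose[rotated])
    moreover have "\<psi> t \<le> G (t / 2 ^ k)" for k
    proof -
      have t: "(t / 2 ^ k)\<^sup>2 * 4 ^ k = t\<^sup>2"
        by (simp add: power_divide power_mult[symmetric] mult.commute[of k] power_mult)
      have eq: "4 ^ k * (4 * pi\<^sup>2 * (t / 2 ^ k)\<^sup>2 * y) = 4 * pi\<^sup>2 * t\<^sup>2 * y" for y :: real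
        unfolding t[symmetric] by (simp only: mult_ac)
      note dyadic[of k]
      also have "4 ^ k * \<psi> (t / 2 ^ k) \<le> G (t / 2 ^ k)"
        unfolding G_def eq[symmetric] using False by (intro mult_left_mono bound) auto
      finally show ?thesis .
    qed
    ultimately show ?thesis by (intro LIMSEQ_le_const) auto
  qed
  then have "L2_norm M (d t) = 0"
    by (simp add: \<psi>_def)
  then show ?thesis
    using L2_norm_eq_0_iff[OF d] by (simp add: d_def e_def)
qed

section \<open>Finite unions of intervals\<close>

lemma ordered_intervals_less: "ordered_intervals \<alpha> \<beta> \<Longrightarrow> \<alpha> $ i < \<beta> $ i"
  by (simp add: ordered_intervals_def)

lemma ordered_intervals_unique:
  assumes "ordered_intervals \<alpha> \<beta>" "x \<in> {\<alpha> $ i<..<\<beta> $ i}" "x \<in> {\<alpha> $ j<..<\<beta> $ j}"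
  shows "i = j"
proof (rule ccontr)
  assume "i \<noteq> j"
  then consider "i < j" | "j < i" by (meson neqE)
  then show False
    using assms by cases (force simp: ordered_intervals_def)+
qed

lemma indicator_interval:
  assumes "ordered_intervals \<alpha> \<beta>" "x \<in> {\<alpha> $ i<..<\<beta> $ i}"
  shows "indicator {\<alpha> $ k<..<\<beta> $ k} x = (if k = i then 1 else (0 :: 'a :: zero_neq_one))"
proof (cases "k = i")
  case False
  then have "x \<notin> {\<alpha> $ k<..<\<beta> $ k}"
    using ordered_intervals_unique[OF assms(1)] assms(2) by blast
  with False show ?thesis by simp
qed (use assms(2) in simp)

lemma interval_subset_Omega: "{\<alpha> $ i<..<\<beta> $ i} \<subseteq> Omega \<alpha> \<beta>"
  by (auto simp: Omega_def)

lemma Omega_sets [measurable]: "Omega \<alpha> \<beta> \<in> sets lebesgue"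
  by (simp add: Omega_def)

text \<open>The end points form a null set, so the Bochner integral over the open interval is the
  gauge integral over the closed one, where the fundamental theorem of calculus applies.\<close>

lemma has_bochner_integral_interval:
  fixes H :: "real \<Rightarrow> 'b::euclidean_space"
  assumes S: "S \<in> sets lebesgue" "{a<..<b} \<subseteq> S" and H: "continuous_on {a..b} H"
  shows "has_bochner_integral (lebesgue_on S) (\<lambda>x. indicator {a<..<b} x *\<^sub>R H x) (integral {a..b} H)"
proof -
  have "H absolutely_integrable_on {a..b}"
    by (rule absolutely_integrable_continuous_real[OF H])
  then have H': "H absolutely_integrable_on {a<..<b}"
    by (rule set_integrable_subset) auto
  have "has_bochner_integral lebesgue (\<lambda>x. indicator {a<..<b} x *\<^sub>R H x) (integral {a<..<b} H)"
    using H' set_lebesgue_integral_eq_integral(2)[OF H']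
    by (simp add: has_bochner_integral_iff set_integrable_def set_lebesgue_integral_def)
  moreover have "indicator S x *\<^sub>R indicator {a<..<b} x *\<^sub>R H x = indicator {a<..<b} x *\<^sub>R H x" for x
    using S by (auto simp: indicator_def)
  moreover have "S \<inter> space lebesgue \<in> sets lebesgue"
    using S by simp
  ultimately show ?thesis
    unfolding integral_open_interval_real
    by (subst has_bochner_integral_restrict_space) (simp_all only:)
qed

text \<open>The intervals are disjoint, so on \<open>Omega\<close> the function is a finite sum of
  indicators times \<open>G i\<close>. Continuity of each \<open>G i\<close> up to the end points
  makes every summand integrable.\<close>

lemma has_bochner_integral_Omega:
  fixes F :: "real \<Rightarrow> 'b::euclidean_space"
  assumes "ordered_intervals \<alpha> \<beta>"
    and G: "\<And>i. continuous_on {\<alpha> $ i..\<beta> $ i} (G i)"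
    and F: "\<And>i x. x \<in> {\<alpha> $ i<..<\<beta> $ i} \<Longrightarrow> F x = G i x"
  shows "has_bochner_integral (lebesgue_on (Omega \<alpha> \<beta>)) F (\<Sum>i\<in>UNIV. integral {\<alpha> $ i..\<beta> $ i} (G i))"
proof -
  have "has_bochner_integral (lebesgue_on (Omega \<alpha> \<beta>))
      (\<lambda>x. \<Sum>i\<in>UNIV. indicator {\<alpha> $ i<..<\<beta> $ i} x *\<^sub>R G i x)
      (\<Sum>i\<in>UNIV. integral {\<alpha> $ i..\<beta> $ i} (G i))"
    by (intro has_bochner_integral_sum has_bochner_integral_interval G interval_subset_Omega Omega_sets)
  moreover have "(\<Sum>i\<in>UNIV. indicator {\<alpha> $ i<..<\<beta> $ i} x *\<^sub>R G i x) = F x"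
    if x: "x \<in> space (lebesgue_on (Omega \<alpha> \<beta>))" for x
  proof -
    from x have "x \<in> Omega \<alpha> \<beta>" by simp
    then obtain k where k: "x \<in> {\<alpha> $ k<..<\<beta> $ k}"
      unfolding Omega_def by blast
    have "(\<Sum>i\<in>UNIV. indicator {\<alpha> $ i<..<\<beta> $ i} x *\<^sub>R G i x) = (\<Sum>i\<in>UNIV. if i = k then G i x else 0)"
      by (intro sum.cong refl) (simp add: indicator_interval[OF assms(1) k])
    then show ?thesis using F[OF k] by simp
  qed
  ultimately show ?thesis
    by (subst (asm) has_bochner_integral_cong[OF refl _ refl]) auto
qed

lemma L2_piecewise_continuous:
  fixes F :: "real \<Rightarrow> complex"
  assumes "ordered_intervals \<alpha> \<beta>"
    and G: "\<And>i. continuous_on {\<alpha> $ i..\<beta> $ i} (G i)"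
    and F: "\<And>i x. x \<in> {\<alpha> $ i<..<\<beta> $ i} \<Longrightarrow> F x = G i x"
  shows "F \<in> L2 (lebesgue_on (Omega \<alpha> \<beta>))"
    and "(L2_norm (lebesgue_on (Omega \<alpha> \<beta>)) F)\<^sup>2
      = (\<Sum>i\<in>UNIV. integral {\<alpha> $ i..\<beta> $ i} (\<lambda>x. (norm (G i x))\<^sup>2))"
proof -
  have 1: "has_bochner_integral (lebesgue_on (Omega \<alpha> \<beta>)) (\<lambda>x. (norm (F x))\<^sup>2)
      (\<Sum>i\<in>UNIV. integral {\<alpha> $ i..\<beta> $ i} (\<lambda>x. (norm (G i x))\<^sup>2))"
    by (rule has_bochner_integral_Omega[OF assms(1)]) (auto intro!: continuous_intros G simp: F)
  have 2: "has_bochner_integral (lebesgue_on (Omega \<alpha> \<beta>)) F (\<Sum>i\<in>UNIV. integral {\<alpha> $ i..\<beta> $ i} (G i))"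
    by (rule has_bochner_integral_Omega[OF assms])
  show "F \<in> L2 (lebesgue_on (Omega \<alpha> \<beta>))"
    using 1 2 by (auto simp: L2_def has_bochner_integral_iff)
  show "(L2_norm (lebesgue_on (Omega \<alpha> \<beta>)) F)\<^sup>2
      = (\<Sum>i\<in>UNIV. integral {\<alpha> $ i..\<beta> $ i} (\<lambda>x. (norm (G i x))\<^sup>2))"
    using 1 by (simp add: L2_norm_sq has_bochner_integral_iff)
qed

lemma L2_continuous:
  assumes "ordered_intervals \<alpha> \<beta>" "continuous_on UNIV f"
  shows "f \<in> L2 (lebesgue_on (Omega \<alpha> \<beta>))"
  using assms by (intro L2_piecewise_continuous(1)[where G = "\<lambda>_. f"])
    (auto intro: continuous_on_subset)

lemma L2_indicator_interval:
  assumes "ordered_intervals \<alpha> \<beta>"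
  shows "indicator {\<alpha> $ k<..<\<beta> $ k} \<in> L2 (lebesgue_on (Omega \<alpha> \<beta>))"
proof (rule L2_piecewise_continuous(1)[OF assms])
  show "continuous_on {\<alpha> $ i..\<beta> $ i} (\<lambda>_. if k = i then 1 else 0 :: complex)" for i
    by (rule continuous_on_const)
  show "indicator {\<alpha> $ k<..<\<beta> $ k} x = (if k = i then 1 else 0 :: complex)"
    if "x \<in> {\<alpha> $ i<..<\<beta> $ i}" for i x
    using assms that by (rule indicator_interval)
qed

lemma indicator_Linf:
  "{a<..<b} \<subseteq> S \<Longrightarrow> S \<in> sets lebesgue \<Longrightarrow> indicator {a<..<b::real} \<in> Linf (lebesgue_on S)"
  unfolding Linf_def
  by (auto intro!: exI[of _ 1] borel_measurable_indicator measurable_restrict_space1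
      simp: indicator_def)

lemma measure_Omega:
  assumes "ordered_intervals \<alpha> \<beta>"
  shows "measure lebesgue (Omega \<alpha> \<beta>) = (\<Sum>i\<in>UNIV. \<beta> $ i - \<alpha> $ i)"
proof -
  have "measure lebesgue (Omega \<alpha> \<beta>) = (\<Sum>i\<in>UNIV. measure lebesgue {\<alpha> $ i<..<\<beta> $ i})"
    unfolding Omega_def
  proof (rule measure_finite_Union)
    show "disjoint_family_on (\<lambda>i. {\<alpha> $ i<..<\<beta> $ i}) UNIV"
      unfolding disjoint_family_on_def using ordered_intervals_unique[OF assms] by blast
    show "emeasure lebesgue {\<alpha> $ i<..<\<beta> $ i} \<noteq> \<infinity>" for i
      using ordered_intervals_less[OF assms, of i] by simp
  qed auto
  also have "\<dots> = (\<Sum>i\<in>UNIV. \<beta> $ i - \<alpha> $ i)"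
    using ordered_intervals_less[OF assms] by (intro sum.cong) (auto simp: less_imp_le)
  finally show ?thesis .
qed

text \<open>A nonempty open interval is not a null set. This turns almost everywhere identities into
  identities at an actual point.\<close>

lemma AE_lebesgue_on_interval_witness:
  assumes "AE x in lebesgue_on S. P x" "S \<in> sets lebesgue" "{a<..<b} \<subseteq> S" "a < (b::real)"
  obtains x where "x \<in> {a<..<b}" "P x"
proof -
  have "\<exists>x\<in>{a<..<b}. P x"
  proof (rule ccontr)
    assume "\<not> (\<exists>x\<in>{a<..<b}. P x)"
    then have "AE x in lebesgue. x \<notin> {a<..<b}"
      using assms by (auto simp: AE_restrict_space_iff elim!: eventually_mono)
    then have "{a<..<b} \<in> null_sets lebesgue"
      by (subst (asm) AE_iff_null_sets[symmetric]) auto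
    then show False using \<open>a < b\<close> by (auto simp: null_sets_def)
  qed
  then show ?thesis using that by blast
qed

section \<open>Exponentials\<close>

lemma e_fun_add: "e_fun \<mu> (x + y) = e_fun \<mu> x * e_fun \<mu> y"
  by (simp add: e_fun_def algebra_simps flip: exp_add)

lemma e_fun_add_freq: "e_fun (\<mu> + \<nu>) x = e_fun \<mu> x * e_fun \<nu> x"
  by (simp add: e_fun_def algebra_simps flip: exp_add)

lemma norm_e_fun [simp]: "norm (e_fun \<mu> x) = 1"
  by (simp add: e_fun_def norm_exp_eq_Re)

lemma e_fun_nonzero [simp]: "e_fun \<mu> x \<noteq> 0"
  by (simp add: e_fun_def)

lemma e_fun_0 [simp]: "e_fun \<mu> 0 = 1"
  by (simp add: e_fun_def)

lemma e_fun_0_freq [simp]: "e_fun 0 x = 1"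
  by (simp add: e_fun_def)

lemma e_fun_diff: "e_fun \<mu> (x - y) = e_fun \<mu> x * cnj (e_fun \<mu> y)"
  by (simp add: e_fun_def exp_cnj algebra_simps flip: exp_add)

lemma e_fun_diff_freq: "e_fun (\<mu> - \<nu>) x = e_fun \<mu> x * cnj (e_fun \<nu> x)"
  by (simp add: e_fun_def exp_cnj algebra_simps flip: exp_add)

lemma e_fun_eq_1_iff: "e_fun \<mu> x = 1 \<longleftrightarrow> \<mu> * x \<in> \<int>"
proof -
  have "e_fun \<mu> x = 1 \<longleftrightarrow> (\<exists>n::int. 2 * pi * (\<mu> * x) = of_int (2 * n) * pi)"
    by (simp add: e_fun_def exp_eq_1 mult.assoc)
  also have "\<dots> \<longleftrightarrow> (\<exists>n::int. \<mu> * x = of_int n)"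
    by (intro arg_cong[where f = Ex] ext) (auto simp: field_simps)
  finally show ?thesis by (auto simp: Ints_def)
qed

lemma e_fun_has_vector_derivative:
  "(e_fun \<mu> has_vector_derivative 2 * of_real pi * \<i> * of_real \<mu> * e_fun \<mu> x) (at x within S)"
proof -
  have "((\<lambda>z. exp (2 * of_real pi * \<i> * of_real \<mu> * z)) has_field_derivative
      2 * of_real pi * \<i> * of_real \<mu> * exp (2 * of_real pi * \<i> * of_real \<mu> * of_real x)) (at (of_real x))"
    by (auto intro!: derivative_eq_intros)
  from has_vector_derivative_real_field[OF this] show ?thesis
    by (simp add: e_fun_def[abs_def])
qed

lemma continuous_on_e_fun [continuous_intros]: "continuous_on S (e_fun \<mu>)"
  by (simp add: e_fun_def[abs_def]) (intro continuous_intros)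

lemma integral_e_fun:
  assumes "\<nu> \<noteq> 0" "a \<le> b"
  shows "integral {a..b} (e_fun \<nu>) = (e_fun \<nu> b - e_fun \<nu> a) / (2 * of_real pi * \<i> * of_real \<nu>)"
proof -
  let ?w = "2 * of_real pi * \<i> * of_real \<nu> :: complex"
  have "((\<lambda>x. ?w * e_fun \<nu> x) has_integral (e_fun \<nu> b - e_fun \<nu> a)) {a..b}"
    by (rule fundamental_theorem_of_calculus[OF assms(2)]) (rule e_fun_has_vector_derivative)
  from has_integral_mult_right[OF this, of "1 / ?w"] show ?thesis
    using assms(1) by (auto simp: integral_unique)
qed

lemma e_fun_lipschitz: "norm (e_fun \<mu> b - e_fun \<mu> a) \<le> 2 * pi * \<bar>\<mu>\<bar> * \<bar>b - a\<bar>"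
proof -
  have "norm (e_fun \<mu> b - e_fun \<mu> a) \<le> 2 * pi * \<bar>\<mu>\<bar> * norm (b - a)"
  proof (rule differentiable_bound[OF convex_UNIV])
    fix x :: real
    show "(e_fun \<mu> has_derivative (\<lambda>h. h *\<^sub>R (2 * of_real pi * \<i> * of_real \<mu> * e_fun \<mu> x))) (at x within UNIV)"
      using e_fun_has_vector_derivative unfolding has_vector_derivative_def by blast
    show "onorm (\<lambda>h. h *\<^sub>R (2 * of_real pi * \<i> * of_real \<mu> * e_fun \<mu> x)) \<le> 2 * pi * \<bar>\<mu>\<bar>"
      by (rule onorm_le) (simp add: norm_mult mult_ac)
  qed auto
  then show ?thesis by simp
qed

lemma absolutely_continuous_on_e_fun: "absolutely_continuous_on S (e_fun \<mu>)"
  unfolding absolutely_continuous_on_def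
proof (intro allI impI)
  fix \<epsilon> :: real assume "\<epsilon> > 0"
  \<comment> \<open>The Lipschitz constant of \<open>e_fun \<mu>\<close>, raised by 1 so that
    \<epsilon> / K makes sense when \<mu> = 0.\<close>
  define K where "K = 2 * pi * \<bar>\<mu>\<bar> + 1"
  have K: "K > 0" by (simp add: K_def add_nonneg_pos)
  show "\<exists>\<delta>>0. \<forall>N a b. (\<forall>k<N. a k \<le> b k \<and> {a k..b k} \<subseteq> S) \<longrightarrow>
        disjoint_family_on (\<lambda>k. {a k<..<b k}) {..<N} \<longrightarrow>
        (\<Sum>k<(N::nat). b k - a k) < \<delta> \<longrightarrow> (\<Sum>k<N. norm (e_fun \<mu> (b k) - e_fun \<mu> (a k))) < \<epsilon>"
  proof (rule exI[of _ "\<epsilon> / K"], intro conjI allI impI)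
    fix N :: nat and a b :: "nat \<Rightarrow> real"
    assume ab: "\<forall>k<N. a k \<le> b k \<and> {a k..b k} \<subseteq> S" and lt: "(\<Sum>k<N. b k - a k) < \<epsilon> / K"
    have "(\<Sum>k<N. norm (e_fun \<mu> (b k) - e_fun \<mu> (a k))) \<le> (\<Sum>k<N. K * (b k - a k))"
    proof (rule sum_mono)
      fix k assume "k \<in> {..<N}"
      then have "a k \<le> b k" using ab by auto
      then show "norm (e_fun \<mu> (b k) - e_fun \<mu> (a k)) \<le> K * (b k - a k)"
        using e_fun_lipschitz[of \<mu> "b k" "a k"] by (simp add: K_def algebra_simps)
    qed
    also have "\<dots> < \<epsilon>"
      using lt K unfolding sum_distrib_left[symmetric] by (simp add: field_simps)
    finally show "(\<Sum>k<N. norm (e_fun \<mu> (b k) - e_fun \<mu> (a k))) < \<epsilon>" .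
  qed (use \<open>\<epsilon> > 0\<close> K in simp)
qed

lemma e_fun_tendsto: "(e_fun \<mu> \<longlongrightarrow> e_fun \<mu> x) (at x within S)"
  using has_vector_derivative_continuous[OF e_fun_has_vector_derivative]
  by (simp add: continuous_within)

lemma trace_left_e_fun: "trace_left \<alpha> (e_fun \<mu>) = (\<chi> i. e_fun \<mu> (\<alpha> $ i))"
  unfolding trace_left_def vec_eq_iff using tendsto_Lim[OF trivial_limit_at_right_real e_fun_tendsto] by simp

lemma trace_right_e_fun: "trace_right \<beta> (e_fun \<mu>) = (\<chi> i. e_fun \<mu> (\<beta> $ i))"
  unfolding trace_right_def vec_eq_iff using tendsto_Lim[OF trivial_limit_at_left_real e_fun_tendsto] by simp

text \<open>A shift by \<open>s\<close> multiplies all values of an exponential by the same factor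
  \<open>e_fun \<mu> s\<close>, so the relation between the traces persists at equal distances from
  the end points.\<close>

lemma boundary_matrix_e_fun:
  assumes "boundary_matrix \<alpha> \<beta> \<Lambda> B" "\<mu> \<in> \<Lambda>"
  shows "(\<Sum>j\<in>UNIV. B $ i $ j * e_fun \<mu> (\<alpha> $ j + s)) = e_fun \<mu> (\<beta> $ i + s)"
proof -
  have "(\<Sum>j\<in>UNIV. B $ i $ j * e_fun \<mu> (\<alpha> $ j)) = e_fun \<mu> (\<beta> $ i)"
    using assms unfolding boundary_matrix_def trace_left_e_fun trace_right_e_fun
    by (auto simp: matrix_vector_mult_def vec_eq_iff)
  then show ?thesis
    by (simp add: e_fun_add flip: sum_distrib_right mult.assoc)
qed

text \<open>The eigenvector hypothesis needed for \<open>exp_group_eigenvector\<close>: exponentials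
  with frequency in \<Lambda> meet the boundary condition and are eigenfunctions of
  differentiation.\<close>

lemma e_fun_D_op:
  assumes o: "ordered_intervals \<alpha> \<beta>" and B: "boundary_matrix \<alpha> \<beta> \<Lambda> B" "\<mu> \<in> \<Lambda>"
  shows "(e_fun \<mu>, \<lambda>x. of_real \<mu> * e_fun \<mu> x) \<in> D_op \<alpha> \<beta> B"
proof -
  have e: "e_fun \<mu> \<in> L2 (lebesgue_on (Omega \<alpha> \<beta>))"
    by (rule L2_continuous[OF o continuous_on_e_fun])
  have vd: "vector_derivative (e_fun \<mu>) (at x) = 2 * of_real pi * \<i> * of_real \<mu> * e_fun \<mu> x" for x
    by (rule vector_derivative_at) (rule e_fun_has_vector_derivative)
  have "e_fun \<mu> \<in> dom_B \<alpha> \<beta> B"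
    using B e by (simp add: dom_B_def dom_max_def vd L2_scale absolutely_continuous_on_e_fun
        boundary_matrix_def)
  then show ?thesis
    using e by (auto simp: D_op_def vd L2_scale intro!: bexI[of _ "e_fun \<mu>"])
qed

section \<open>Local translation and the boundary matrix\<close>

lemma L2_norm_indicator_le:
  assumes "f \<in> L2 M" "indicator A \<in> Linf M"
  shows "L2_norm M (\<lambda>x. indicator A x * f x) \<le> L2_norm M f"
  unfolding L2_norm_def
proof (intro real_sqrt_le_mono integral_mono)
  show "integrable M (\<lambda>x. (norm (indicator A x * f x))\<^sup>2)"
    using L2_mult_Linf[OF assms(2,1)] by (rule L2_integrable_sq)
  show "integrable M (\<lambda>x. (norm (f x))\<^sup>2)"
    using assms(1) by (rule L2_integrable_sq)
qed (simp add: indicator_def)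

lemma unitary_matrix_row_inner:
  assumes "unitary_matrix B"
  shows "(\<Sum>j\<in>UNIV. B $ i $ j * cnj (B $ i' $ j)) = (if i = i' then 1 else 0)"
proof -
  have "(B ** transpose (map_matrix cnj B)) $ i $ i' = (mat 1 :: complex ^ 'a ^ 'a) $ i $ i'"
    using assms by (simp add: unitary_matrix_def)
  then show ?thesis
    by (simp add: matrix_matrix_mult_def transpose_def map_matrix_def mat_def)
qed

lemma unitary_matrix_row_norm:
  assumes "unitary_matrix B" shows "(\<Sum>j\<in>UNIV. (norm (B $ i $ j))\<^sup>2) = 1"
proof -
  have "complex_of_real (\<Sum>j\<in>UNIV. (norm (B $ i $ j))\<^sup>2) = 1"
    using unitary_matrix_row_inner[OF assms, of i i]
    unfolding of_real_sum complex_norm_square by simp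
  then show ?thesis using of_real_eq_1_iff by blast
qed

lemma unitary_matrix_norm_le_1:
  assumes "unitary_matrix B" shows "norm (B $ i $ j) \<le> 1"
proof -
  have "(norm (B $ i $ j))\<^sup>2 \<le> (\<Sum>j\<in>UNIV. (norm (B $ i $ j))\<^sup>2)"
    by (intro member_le_sum) auto
  then show ?thesis
    unfolding unitary_matrix_row_norm[OF assms] by (simp add: power_le_one_iff)
qed

text \<open>Rows have norm 1, so each has exactly one nonzero entry, of modulus 1. Two rows with
  that entry in the same column could not be orthogonal, hence \<sigma> is injective.\<close>

lemma unitary_matrix_weighted_permutation:
  fixes B :: "complex ^ 'n ^ 'n"
  assumes B: "unitary_matrix B"
    and single: "\<And>i j k. j \<noteq> k \<Longrightarrow> B $ i $ j \<noteq> 0 \<Longrightarrow> B $ i $ k = 0"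
  obtains \<sigma> where "\<sigma> permutes UNIV" "weighted_permutation_matrix B \<sigma>"
proof -
  have "\<exists>j. B $ i $ j \<noteq> 0" for i
  proof (rule ccontr)
    assume "\<not> (\<exists>j. B $ i $ j \<noteq> 0)"
    then show False using unitary_matrix_row_norm[OF B, of i] by simp
  qed
  then obtain \<sigma> where \<sigma>: "\<And>i. B $ i $ \<sigma> i \<noteq> 0" by metis
  have zero: "B $ i $ j = 0" if "j \<noteq> \<sigma> i" for i j
    using single[OF that[symmetric] \<sigma>] .
  have row: "(\<Sum>j\<in>UNIV. B $ i $ j * cnj (B $ i' $ j)) = B $ i $ \<sigma> i * cnj (B $ i' $ \<sigma> i)" for i i'
  proof -
    have "(\<Sum>j\<in>UNIV. B $ i $ j * cnj (B $ i' $ j))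
        = (\<Sum>j\<in>UNIV. if j = \<sigma> i then B $ i $ \<sigma> i * cnj (B $ i' $ \<sigma> i) else 0)"
      by (intro sum.cong refl) (simp add: zero)
    then show ?thesis by simp
  qed
  have "inj \<sigma>"
  proof (rule injI, rule ccontr)
    fix i i' assume "\<sigma> i = \<sigma> i'" "i \<noteq> i'"
    then show False
      using row[of i i'] unitary_matrix_row_inner[OF B, of i i'] \<sigma>[of i] \<sigma>[of i'] by simp
  qed
  then have "\<sigma> permutes UNIV"
    by (intro bij_imp_permutes bijI finite_UNIV_inj_surj) auto
  moreover have "norm (B $ i $ \<sigma> i) = 1" for i
  proof -
    have "complex_of_real ((norm (B $ i $ \<sigma> i))\<^sup>2) = 1"
      using row[of i i] unitary_matrix_row_inner[OF B, of i i]
      unfolding complex_norm_square by simp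
    then have "(norm (B $ i $ \<sigma> i))\<^sup>2 = 1" using of_real_eq_1_iff by blast
    then have "norm (B $ i $ \<sigma> i) = 1 \<or> norm (B $ i $ \<sigma> i) = - 1"
      by (simp only: power2_eq_1_iff)
    then show ?thesis using norm_ge_zero[of "B $ i $ \<sigma> i"] by linarith
  qed
  ultimately show ?thesis
    using that zero by (auto simp: weighted_permutation_matrix_def)
qed

section \<open>Trigonometric sums across the end points\<close>

locale spectral_union =
  fixes \<alpha> \<beta> :: "real ^ ('n :: {finite, linorder})"
    and \<Lambda> :: "real set"
    and B :: "complex ^ ('n :: {finite, linorder}) ^ ('n :: {finite, linorder})"
  assumes ordered: "ordered_intervals \<alpha> \<beta>"
    and spectrum: "spectrum_of (Omega \<alpha> \<beta>) \<Lambda>"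
    and boundary: "boundary_matrix \<alpha> \<beta> \<Lambda> B"
begin

abbreviation M where "M \<equiv> lebesgue_on (Omega \<alpha> \<beta>)"

lemma unitary_B: "unitary_matrix B"
  using boundary by (simp add: boundary_matrix_def)

lemma e_fun_L2: "e_fun \<mu> \<in> L2 M"
  by (rule L2_continuous[OF ordered continuous_on_e_fun])

lemma span_L2:
  assumes "finite F" "F \<subseteq> e_fun ` \<Lambda>"
  shows "(\<lambda>x. \<Sum>h\<in>F. c h * h x) \<in> L2 M"
  using assms by (intro L2_sum L2_scale) (auto intro: e_fun_L2)

lemma span_boundary:
  assumes "F \<subseteq> e_fun ` \<Lambda>"
  shows "(\<Sum>j\<in>UNIV. B $ i $ j * (\<Sum>h\<in>F. c h * h (\<alpha> $ j + s))) = (\<Sum>h\<in>F. c h * h (\<beta> $ i + s))"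
proof -
  have "(\<Sum>j\<in>UNIV. B $ i $ j * (\<Sum>h\<in>F. c h * h (\<alpha> $ j + s)))
      = (\<Sum>h\<in>F. c h * (\<Sum>j\<in>UNIV. B $ i $ j * h (\<alpha> $ j + s)))"
    by (simp add: sum_distrib_left mult.left_commute) (rule sum.swap)
  also have "\<dots> = (\<Sum>h\<in>F. c h * h (\<beta> $ i + s))"
    using assms by (intro sum.cong refl) (auto simp: boundary_matrix_e_fun[OF boundary])
  finally show ?thesis .
qed

text \<open>Think of \<open>p\<close> as approximating the indicator of interval \<open>k\<close>.
  For x within t of \<beta>_i, p(x + t) is the combination of the values p(\<alpha>_j + s) with the
  weights of row i. As t is at most every length, \<alpha>_j + s stays in interval j, where p is
  close to 1 if j = k and to 0 otherwise. The factor n comes from Cauchy-Schwarz.\<close>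

lemma span_defect_bound:
  fixes c :: "(real \<Rightarrow> complex) \<Rightarrow> complex"
  assumes F: "finite F" "F \<subseteq> e_fun ` \<Lambda>" and p_def: "p = (\<lambda>x. \<Sum>h\<in>F. c h * h x)"
    and t: "0 < t" "\<And>j. t \<le> \<beta> $ j - \<alpha> $ j"
  shows "integral {\<beta> $ i - t..\<beta> $ i} (\<lambda>x. (norm (p (x + t) - B $ i $ k))\<^sup>2)
    \<le> real CARD('n) * (L2_norm M (\<lambda>x. indicator {\<alpha> $ k<..<\<beta> $ k} x - p x))\<^sup>2"
proof -
  define q where "q j y = (norm ((if k = j then 1 else 0) - p y))\<^sup>2" for j y
  have p_cont: "continuous_on S p" for S
    unfolding p_def using F by (auto intro!: continuous_intros)
  have q_cont: "continuous_on S (q j)" for S j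
    unfolding q_def by (intro continuous_intros p_cont)
  have pointwise: "(norm (p (x + t) - B $ i $ k))\<^sup>2
      \<le> (\<Sum>j\<in>UNIV. real CARD('n) * q j (x + (\<alpha> $ j - (\<beta> $ i - t))))" for x
  proof -
    \<comment> \<open>The distance by which x + t has passed \<beta>_i.\<close>
    define s where "s = x + t - \<beta> $ i"
    have *: "x + (\<alpha> $ j - (\<beta> $ i - t)) = \<alpha> $ j + s" for j by (simp add: s_def)
    have "p (x + t) = (\<Sum>j\<in>UNIV. B $ i $ j * p (\<alpha> $ j + s))"
      unfolding p_def span_boundary[OF F(2)] by (simp add: s_def)
    moreover have "B $ i $ k = (\<Sum>j\<in>UNIV. B $ i $ j * (if k = j then 1 else 0))"
      by (simp add: mult_delta_right)
    ultimately have "p (x + t) - B $ i $ k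
        = (\<Sum>j\<in>UNIV. B $ i $ j * (p (\<alpha> $ j + s) - (if k = j then 1 else 0)))"
      by (simp only: right_diff_distrib sum_subtractf)
    then have "norm (p (x + t) - B $ i $ k)
        \<le> (\<Sum>j\<in>UNIV. norm (B $ i $ j * (p (\<alpha> $ j + s) - (if k = j then 1 else 0))))"
      by (simp add: norm_sum)
    also have "\<dots> \<le> (\<Sum>j\<in>UNIV. norm ((if k = j then 1 else 0) - p (\<alpha> $ j + s)))"
    proof (rule sum_mono)
      fix j
      have "norm (B $ i $ j * (p (\<alpha> $ j + s) - (if k = j then 1 else 0)))
          \<le> 1 * norm (p (\<alpha> $ j + s) - (if k = j then 1 else 0))"
        unfolding norm_mult by (intro mult_right_mono unitary_matrix_norm_le_1 unitary_B) auto
      then show "norm (B $ i $ j * (p (\<alpha> $ j + s) - (if k = j then 1 else 0)))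
          \<le> norm ((if k = j then 1 else 0) - p (\<alpha> $ j + s))"
        by (simp only: norm_minus_commute mult_1)
    qed
    finally have "(norm (p (x + t) - B $ i $ k))\<^sup>2
        \<le> (\<Sum>j\<in>UNIV. norm ((if k = j then 1 else 0) - p (\<alpha> $ j + s)))\<^sup>2"
      by (intro power_mono) auto
    also have "\<dots> \<le> (\<Sum>j\<in>UNIV. q j (\<alpha> $ j + s)) * real CARD('n)"
      unfolding q_def by (rule sum_squared_le_sum_of_squares)
    also have "\<dots> = (\<Sum>j\<in>UNIV. real CARD('n) * q j (\<alpha> $ j + s))"
      by (simp add: sum_distrib_left[symmetric] mult.commute)
    finally show ?thesis unfolding * .
  qed
  have "continuous_on S (\<lambda>x. q j (x + c))" for S j c
    by (rule continuous_on_compose2[OF q_cont[of UNIV]]) (auto intro!: continuous_intros)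
  then have q_int: "(\<lambda>x. real CARD('n) * q j (x + c)) integrable_on {a..b}" for j a b c
    by (intro integrable_continuous_real continuous_intros)
  have "integral {\<beta> $ i - t..\<beta> $ i} (\<lambda>x. (norm (p (x + t) - B $ i $ k))\<^sup>2)
      \<le> integral {\<beta> $ i - t..\<beta> $ i} (\<lambda>x. \<Sum>j\<in>UNIV. real CARD('n) * q j (x + (\<alpha> $ j - (\<beta> $ i - t))))"
  proof (rule integral_le)
    have "continuous_on S (\<lambda>x. p (x + t))" for S
      by (rule continuous_on_compose2[OF p_cont[of UNIV]]) (auto intro!: continuous_intros)
    then show "(\<lambda>x. (norm (p (x + t) - B $ i $ k))\<^sup>2) integrable_on {\<beta> $ i - t..\<beta> $ i}"
      by (intro integrable_continuous_real continuous_intros)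
  qed (use pointwise q_int in \<open>auto intro: integrable_sum\<close>)
  also have "\<dots> = (\<Sum>j\<in>UNIV. integral {\<beta> $ i - t..\<beta> $ i}
      (\<lambda>x. real CARD('n) * q j (x + (\<alpha> $ j - (\<beta> $ i - t)))))"
    by (rule integral_sum) (simp_all add: q_int)
  \<comment> \<open>A shift moves the last piece of interval i, of length t, onto
    [\<alpha>_j, \<alpha>_j + t], which lies inside interval j.\<close>
  also have "\<dots> \<le> (\<Sum>j\<in>UNIV. real CARD('n) * integral {\<alpha> $ j..\<beta> $ j} (q j))"
  proof (rule sum_mono)
    fix j
    have "integral {\<beta> $ i - t..\<beta> $ i} (\<lambda>x. q j (x + (\<alpha> $ j - (\<beta> $ i - t))))
        = integral {\<alpha> $ j..\<alpha> $ j + t} (q j)"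
      using integral_shift[OF q_cont[of _ j], of "\<beta> $ i - t" "\<beta> $ i" "\<alpha> $ j - (\<beta> $ i - t)"]
      by (simp add: o_def algebra_simps)
    also have "\<dots> \<le> integral {\<alpha> $ j..\<beta> $ j} (q j)"
      using t(2)[of j] by (intro integral_subset_le integrable_continuous_real q_cont) (auto simp: q_def)
    finally show "integral {\<beta> $ i - t..\<beta> $ i} (\<lambda>x. real CARD('n) * q j (x + (\<alpha> $ j - (\<beta> $ i - t))))
        \<le> real CARD('n) * integral {\<alpha> $ j..\<beta> $ j} (q j)"
      by (simp add: mult_left_mono)
  qed
  also have "\<dots> = real CARD('n) * (L2_norm M (\<lambda>x. indicator {\<alpha> $ k<..<\<beta> $ k} x - p x))\<^sup>2"
  proof -
    have "(L2_norm M (\<lambda>x. indicator {\<alpha> $ k<..<\<beta> $ k} x - p x))\<^sup>2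
        = (\<Sum>j\<in>UNIV. integral {\<alpha> $ j..\<beta> $ j} (\<lambda>x. (norm ((if k = j then 1 else 0) - p x))\<^sup>2))"
      by (rule L2_piecewise_continuous(2)[OF ordered])
        (auto intro!: continuous_intros p_cont simp: indicator_interval[OF ordered])
    then show ?thesis by (simp add: q_def[abs_def] sum_distrib_left)
  qed
  finally show ?thesis .
qed

end

section \<open>The action of the group and the Forelli condition\<close>

locale spectral_group = spectral_union \<alpha> \<beta> \<Lambda> B
  for \<alpha> \<beta> :: "real ^ ('n :: {finite, linorder})" and \<Lambda> B +
  fixes U :: "real \<Rightarrow> (real \<Rightarrow> complex) \<Rightarrow> real \<Rightarrow> complex"
  assumes group: "exp_group M (D_op \<alpha> \<beta> B) U"
begin

lemma unitary_U: "L2_unitary M (U t)"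
  by (rule exp_group_unitary[OF group])

lemma U_e_fun:
  assumes "\<mu> \<in> \<Lambda>" shows "AE x in M. U t (e_fun \<mu>) x = e_fun \<mu> (x + t)"
  using exp_group_eigenvector[OF group e_fun_L2 e_fun_D_op[OF ordered boundary assms], of t,
      folded e_fun_def]
  by (simp add: e_fun_add mult.commute)

lemma U_span:
  assumes "finite F" "F \<subseteq> e_fun ` \<Lambda>"
  shows "AE x in M. U t (\<lambda>x. \<Sum>h\<in>F. c h * h x) x = (\<Sum>h\<in>F. c h * h (x + t))"
proof -
  have "AE x in M. U t (\<lambda>x. \<Sum>h\<in>F. c h * h x) x = (\<Sum>h\<in>F. c h * U t h x)"
    using assms by (intro L2_unitary_sum[OF unitary_U]) (auto intro: e_fun_L2)
  moreover have "AE x in M. \<forall>h\<in>F. U t h x = h (x + t)"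
    using assms U_e_fun by (intro AE_finite_allI) auto
  ultimately show ?thesis
    by eventually_elim simp
qed

text \<open>Within \<open>t\<close> of the right end of interval \<open>i\<close>, translation by \<open>t\<close> leaves the interval, and
  $U(t)f$ reads the values of $f$ just after the left ends, weighted by row \<open>i\<close> of \<open>B\<close>.\<close>

lemma U_indicator:
  assumes t: "0 < t" "\<And>j. t \<le> \<beta> $ j - \<alpha> $ j"
  shows "AE x in M. x \<in> {\<beta> $ i - t<..<\<beta> $ i} \<longrightarrow>
    U t (indicator {\<alpha> $ k<..<\<beta> $ k}) x = B $ i $ k"
proof -
  define J where "J = {\<beta> $ i - t<..<\<beta> $ i}"
  define f :: "real \<Rightarrow> complex" where "f = indicator {\<alpha> $ k<..<\<beta> $ k}"
  have J: "J \<subseteq> Omega \<alpha> \<beta>"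
    using t(2)[of i] interval_subset_Omega[of \<alpha> i \<beta>] by (force simp: J_def)
  then have ind: "indicator J \<in> Linf M"
    unfolding J_def by (rule indicator_Linf) (rule Omega_sets)
  have f: "f \<in> L2 M" unfolding f_def by (rule L2_indicator_interval[OF ordered])
  have const: "(\<lambda>x. B $ i $ k) \<in> L2 M" by (rule L2_continuous[OF ordered continuous_on_const])
  define D where "D = (\<lambda>x. indicator J x * (U t f x - B $ i $ k))"
  have D: "D \<in> L2 M"
    unfolding D_def by (intro L2_mult_Linf ind L2_diff const L2_unitary_mem[OF unitary_U] f)
  \<comment> \<open>The 2 comes from the error \<open>D1\<close> and 2n from the defect
    \<open>D2\<close>, each doubled by \<open>L2_norm_add_sq_le\<close>.\<close>
  define K where "K = 2 + 2 * real CARD('n)"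
  have K: "K > 0" by (simp add: K_def add_pos_nonneg)
  have bound: "(L2_norm M D)\<^sup>2 \<le> K * \<epsilon>\<^sup>2" if "\<epsilon> > 0" for \<epsilon>
  proof -
    obtain F c where F: "finite F" "F \<subseteq> e_fun ` \<Lambda>"
      and lt: "L2_norm M (\<lambda>x. f x - (\<Sum>h\<in>F. c h * h x)) < \<epsilon>"
      using spectrum f \<open>\<epsilon> > 0\<close> unfolding spectrum_of_def L2_orthogonal_basis_def by meson
    define p where "p = (\<lambda>x. \<Sum>h\<in>F. c h * h x)"
    have p: "p \<in> L2 M" unfolding p_def by (rule span_L2[OF F])
    have Up: "AE x in M. U t p x = p (x + t)" unfolding p_def by (rule U_span[OF F])
    note UL2 = L2_unitary_mem[OF unitary_U]
    \<comment> \<open>\<open>D1\<close> is the cost of replacing f by p, controlled because U(t) is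
      an isometry; \<open>D2\<close> is the defect of p itself, on which U(t) acts as translation by
      t.\<close>
    define D1 where "D1 = (\<lambda>x. indicator J x * (U t f x - U t p x))"
    define D2 where "D2 = (\<lambda>x. indicator J x * (U t p x - B $ i $ k))"
    have D12: "D1 \<in> L2 M" "D2 \<in> L2 M"
      unfolding D1_def D2_def by (intro L2_mult_Linf ind L2_diff const UL2 f p)+
    have "L2_norm M D1 \<le> L2_norm M (\<lambda>x. U t f x - U t p x)"
      unfolding D1_def by (intro L2_norm_indicator_le ind L2_diff UL2 f p)
    also have "\<dots> = L2_norm M (U t (\<lambda>x. f x - p x))"
      using L2_unitary_diff[OF unitary_U f p, of t]
      by (intro L2_norm_cong_AE L2_diff UL2 f p) (auto elim: eventually_mono)
    also have "\<dots> = L2_norm M (\<lambda>x. f x - p x)"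
      by (intro L2_unitary_norm[OF unitary_U] L2_diff f p)
    finally have D1: "(L2_norm M D1)\<^sup>2 \<le> (L2_norm M (\<lambda>x. f x - p x))\<^sup>2"
      by (intro power_mono L2_norm_nonneg)
    have p_cont: "continuous_on S p" for S
      unfolding p_def using F by (auto intro!: continuous_intros)
    have "continuous_on S (\<lambda>x. p (x + t))" for S
      by (rule continuous_on_compose2[OF p_cont[of UNIV]]) (auto intro!: continuous_intros)
    then have "has_bochner_integral M (\<lambda>x. indicator J x *\<^sub>R (norm (p (x + t) - B $ i $ k))\<^sup>2)
        (integral {\<beta> $ i - t..\<beta> $ i} (\<lambda>x. (norm (p (x + t) - B $ i $ k))\<^sup>2))"
      using J unfolding J_def
      by (intro has_bochner_integral_interval Omega_sets continuous_intros)
    moreover have "AE x in M. (norm (D2 x))\<^sup>2 = indicator J x *\<^sub>R (norm (p (x + t) - B $ i $ k))\<^sup>2"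
      using Up by eventually_elim (simp add: D2_def indicator_def)
    ultimately have "(L2_norm M D2)\<^sup>2 = integral {\<beta> $ i - t..\<beta> $ i} (\<lambda>x. (norm (p (x + t) - B $ i $ k))\<^sup>2)"
      unfolding L2_norm_sq using L2_integrable_sq[OF D12(2)]
      by (subst integral_cong_AE) (auto simp: has_bochner_integral_iff)
    also have "\<dots> \<le> real CARD('n) * (L2_norm M (\<lambda>x. f x - p x))\<^sup>2"
      unfolding f_def by (rule span_defect_bound[OF F p_def t])
    finally have D2: "(L2_norm M D2)\<^sup>2 \<le> real CARD('n) * (L2_norm M (\<lambda>x. f x - p x))\<^sup>2" .
    have "D = (\<lambda>x. D1 x + D2 x)"
      by (auto simp: D_def D1_def D2_def algebra_simps)
    then have "(L2_norm M D)\<^sup>2 \<le> 2 * (L2_norm M D1)\<^sup>2 + 2 * (L2_norm M D2)\<^sup>2"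
      using L2_norm_add_sq_le[OF D12] by simp
    also have "\<dots> \<le> K * (L2_norm M (\<lambda>x. f x - p x))\<^sup>2"
      using D1 D2 by (simp add: K_def algebra_simps)
    also have "\<dots> \<le> K * \<epsilon>\<^sup>2"
      using K lt by (intro mult_left_mono power_mono L2_norm_nonneg) (auto simp: p_def)
    finally show ?thesis .
  qed
  have "(L2_norm M D)\<^sup>2 \<le> 0"
  proof (rule field_le_epsilon)
    fix e :: real assume "e > 0"
    then show "(L2_norm M D)\<^sup>2 \<le> 0 + e"
      \<comment> \<open>This \<epsilon> makes K \<epsilon>^2 equal to e.\<close>
      using bound[of "sqrt (e / K)"] K by simp
  qed
  then have "AE x in M. D x = 0"
    using L2_norm_eq_0_iff[OF D] by simp
  then show ?thesis
    by eventually_elim (auto simp: D_def J_def f_def indicator_def split: if_splits)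
qed

text \<open>Intertwine multiplication by the indicator of interval j with U(t) and test it on the
  indicators of intervals j and k, whose products with it are itself and 0. Near \<beta>_i this
  reads h b_ij = b_ij and h b_ik = 0, so h = 1 and b_ik = 0.\<close>

lemma forelli_boundary_row:
  assumes "forelli M U" and "j \<noteq> k" "B $ i $ j \<noteq> 0"
  shows "B $ i $ k = 0"
proof -
  \<comment> \<open>With t the least length, a translation by t cannot jump over a whole
    interval.\<close>
  define t where "t = Min (range (\<lambda>j. \<beta> $ j - \<alpha> $ j))"
  have t: "0 < t" "\<And>j. t \<le> \<beta> $ j - \<alpha> $ j"
    using ordered_intervals_less[OF ordered] by (auto simp: t_def)
  let ?I = "\<lambda>j. indicator {\<alpha> $ j<..<\<beta> $ j} :: real \<Rightarrow> complex"
  obtain h where h: "\<And>f. f \<in> L2 M \<Longrightarrow> AE x in M. U t (\<lambda>y. ?I j y * f y) x = h x * U t f x"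
    using forelli_intertwine[OF group assms(1) indicator_Linf[OF interval_subset_Omega Omega_sets]]
    by blast
  have jj: "(\<lambda>y. ?I j y * ?I j y) = ?I j"
    by (auto simp: indicator_def)
  have "?I j y * ?I k y = 0" for y
  proof (cases "y \<in> {\<alpha> $ j<..<\<beta> $ j}")
    case True
    then show ?thesis using indicator_interval[OF ordered True, of k] \<open>j \<noteq> k\<close> by simp
  qed simp
  then have jk: "(\<lambda>y. ?I j y * ?I k y) = (\<lambda>y. 0)" by blast
  have "AE x in M. x \<in> {\<beta> $ i - t<..<\<beta> $ i} \<longrightarrow> B $ i $ j = h x * B $ i $ j \<and> 0 = h x * B $ i $ k"
    using h[OF L2_indicator_interval[OF ordered, of j]] h[OF L2_indicator_interval[OF ordered, of k]]
      U_indicator[OF t, of i j] U_indicator[OF t, of i k] L2_unitary_zero[OF unitary_U, of t]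
    unfolding jj jk by eventually_elim metis
  then obtain x where "x \<in> {\<beta> $ i - t<..<\<beta> $ i}"
      "x \<in> {\<beta> $ i - t<..<\<beta> $ i} \<longrightarrow> B $ i $ j = h x * B $ i $ j \<and> 0 = h x * B $ i $ k"
  proof (rule AE_lebesgue_on_interval_witness[OF _ Omega_sets])
    show "{\<beta> $ i - t<..<\<beta> $ i} \<subseteq> Omega \<alpha> \<beta>"
      using t(2)[of i] interval_subset_Omega[of \<alpha> i \<beta>] by force
  qed (use t in auto)
  then have "B $ i $ j = h x * B $ i $ j" "h x * B $ i $ k = 0" by simp_all
  with \<open>B $ i $ j \<noteq> 0\<close> show ?thesis
    by (metis mult_cancel_right1 mult_1)
qed

end

section \<open>The spectrum of a weighted permutation matrix\<close>

lemma e_fun_sum: "finite A \<Longrightarrow> e_fun \<mu> (\<Sum>i\<in>A. f i) = (\<Prod>i\<in>A. e_fun \<mu> (f i))"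
  by (induction A rule: finite_induct) (auto simp: e_fun_add)

locale weighted_union = spectral_union \<alpha> \<beta> \<Lambda> B
  for \<alpha> \<beta> :: "real ^ ('n :: {finite, linorder})" and \<Lambda> B +
  fixes \<sigma> :: "'n \<Rightarrow> 'n"
  assumes permutes: "\<sigma> permutes UNIV"
    and weighted: "weighted_permutation_matrix B \<sigma>"
begin

definition len where "len i = \<beta> $ i - \<alpha> $ i"

definition L where "L = (\<Sum>i\<in>UNIV. len i)"

lemma len_pos: "len i > 0"
  using ordered_intervals_less[OF ordered, of i] by (simp add: len_def)

lemma L_pos: "L > 0"
  unfolding L_def by (intro sum_pos) (auto simp: len_pos)

lemma norm_weight: "norm (B $ i $ \<sigma> i) = 1"
  using weighted by (simp add: weighted_permutation_matrix_def)

lemma weight_mult_cnj: "B $ i $ \<sigma> i * cnj (B $ i $ \<sigma> i) = 1"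
  using norm_weight[of i] by (simp add: complex_norm_square[symmetric])

lemma sum_permute: "(\<Sum>i\<in>UNIV. f (\<sigma> i)) = (\<Sum>i\<in>UNIV. f i)"
  using sum.permute[OF permutes, of f] by (simp add: o_def)

lemma prod_permute: "(\<Prod>i\<in>UNIV. f (\<sigma> i)) = (\<Prod>i\<in>UNIV. f i)"
  using prod.permute[OF permutes, of f] by (simp add: o_def)

lemma e_fun_boundary:
  assumes "\<mu> \<in> \<Lambda>" shows "e_fun \<mu> (\<beta> $ i) = B $ i $ \<sigma> i * e_fun \<mu> (\<alpha> $ \<sigma> i)"
proof -
  have "e_fun \<mu> (\<beta> $ i) = (\<Sum>j\<in>UNIV. B $ i $ j * e_fun \<mu> (\<alpha> $ j))"
    using boundary_matrix_e_fun[OF boundary assms, of i 0] by simp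
  also have "\<dots> = (\<Sum>j\<in>UNIV. if j = \<sigma> i then B $ i $ \<sigma> i * e_fun \<mu> (\<alpha> $ \<sigma> i) else 0)"
    using weighted by (intro sum.cong refl) (simp add: weighted_permutation_matrix_def)
  finally show ?thesis by simp
qed

lemma weight_eq:
  assumes "\<mu> \<in> \<Lambda>" shows "B $ i $ \<sigma> i = e_fun \<mu> (\<beta> $ i - \<alpha> $ \<sigma> i)"
proof -
  have "B $ i $ \<sigma> i * (e_fun \<mu> (\<alpha> $ \<sigma> i) * cnj (e_fun \<mu> (\<alpha> $ \<sigma> i))) = e_fun \<mu> (\<beta> $ i - \<alpha> $ \<sigma> i)"
    by (simp add: e_fun_diff e_fun_boundary[OF assms])
  then show ?thesis by (simp add: complex_norm_square[symmetric])
qed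

text \<open>If the piecewise exponential with coefficients \<open>c\<close> satisfies the boundary condition, then
  its inner product with any \<open>e_fun \<mu>\<close>, \<open>\<mu> \<in> \<Lambda>\<close>, telescopes along the permutation.\<close>

lemma boundary_solution_zero:
  assumes c: "\<And>i. c i * e_fun \<nu> (\<beta> $ i) = B $ i $ \<sigma> i * c (\<sigma> i) * e_fun \<nu> (\<alpha> $ \<sigma> i)"
    and mean: "\<nu> \<in> \<Lambda> \<Longrightarrow> (\<Sum>i\<in>UNIV. c i * of_real (len i)) = 0"
  shows "c i = 0"
proof -
  define h where "h x = (\<Sum>k\<in>UNIV. indicator {\<alpha> $ k<..<\<beta> $ k} x * (c k * e_fun \<nu> x))" for x
  have h_eq: "h x = c i * e_fun \<nu> x" if x: "x \<in> {\<alpha> $ i<..<\<beta> $ i}" for x i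
  proof -
    have "h x = (\<Sum>k\<in>UNIV. if k = i then c i * e_fun \<nu> x else 0)"
      unfolding h_def by (intro sum.cong refl) (simp add: indicator_interval[OF ordered x])
    then show ?thesis by simp
  qed
  have h: "h \<in> L2 M"
    by (rule L2_piecewise_continuous(1)[OF ordered, where G = "\<lambda>i x. c i * e_fun \<nu> x"])
      (auto intro!: continuous_intros simp: h_eq)
  have "L2_inner M h (e_fun \<mu>) = 0" if \<mu>: "\<mu> \<in> \<Lambda>" for \<mu>
  proof -
    have "has_bochner_integral M (\<lambda>x. h x * cnj (e_fun \<mu> x))
        (\<Sum>i\<in>UNIV. integral {\<alpha> $ i..\<beta> $ i} (\<lambda>x. c i * e_fun (\<nu> - \<mu>) x))"
      by (rule has_bochner_integral_Omega[OF ordered])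
        (auto intro!: continuous_intros simp: h_eq e_fun_diff_freq)
    then have inner: "L2_inner M h (e_fun \<mu>)
        = (\<Sum>i\<in>UNIV. c i * integral {\<alpha> $ i..\<beta> $ i} (e_fun (\<nu> - \<mu>)))"
      by (simp add: L2_inner_def has_bochner_integral_iff)
    show ?thesis
    proof (cases "\<nu> = \<mu>")
      \<comment> \<open>Here \<nu> itself lies in \<Lambda>, and the inner product is the sum of c_i
        l_i, which \<open>mean\<close> makes zero.\<close>
      case True
      have "e_fun 0 = (\<lambda>x. 1)" by auto
      then have "integral {\<alpha> $ i..\<beta> $ i} (e_fun (\<nu> - \<mu>)) = of_real (len i)" for i
        using len_pos[of i] True by (simp add: len_def scaleR_conv_of_real)
      then show ?thesis using inner mean \<mu> True by simp
    next
      case False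
      define w where "w = 2 * of_real pi * \<i> * (of_real (\<nu> - \<mu>) :: complex)"
      \<comment> \<open>Multiplying the boundary condition for \<nu> by the conjugate of that for
        \<mu> cancels the unimodular weight.\<close>
      have "c i * e_fun (\<nu> - \<mu>) (\<beta> $ i) = c (\<sigma> i) * e_fun (\<nu> - \<mu>) (\<alpha> $ \<sigma> i)" for i
      proof -
        have "c i * e_fun (\<nu> - \<mu>) (\<beta> $ i) = (c i * e_fun \<nu> (\<beta> $ i)) * cnj (e_fun \<mu> (\<beta> $ i))"
          by (simp add: e_fun_diff_freq)
        also have "\<dots> = (B $ i $ \<sigma> i * cnj (B $ i $ \<sigma> i)) *
            (c (\<sigma> i) * (e_fun \<nu> (\<alpha> $ \<sigma> i) * cnj (e_fun \<mu> (\<alpha> $ \<sigma> i))))"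
          unfolding c e_fun_boundary[OF \<mu>] by (simp add: mult_ac)
        finally show ?thesis by (simp add: weight_mult_cnj e_fun_diff_freq)
      qed
      then have "(\<Sum>i\<in>UNIV. c i * e_fun (\<nu> - \<mu>) (\<beta> $ i)) = (\<Sum>i\<in>UNIV. c i * e_fun (\<nu> - \<mu>) (\<alpha> $ i))"
        by (simp add: sum_permute[of "\<lambda>i. c i * e_fun (\<nu> - \<mu>) (\<alpha> $ i)"])
      then have "(\<Sum>i\<in>UNIV. c i * (e_fun (\<nu> - \<mu>) (\<beta> $ i) - e_fun (\<nu> - \<mu>) (\<alpha> $ i)) / w) = 0"
        unfolding sum_divide_distrib[symmetric] by (simp add: right_diff_distrib sum_subtractf)
      moreover have "integral {\<alpha> $ i..\<beta> $ i} (e_fun (\<nu> - \<mu>))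
          = (e_fun (\<nu> - \<mu>) (\<beta> $ i) - e_fun (\<nu> - \<mu>) (\<alpha> $ i)) / w" for i
        unfolding w_def using False len_pos[of i] by (intro integral_e_fun) (auto simp: len_def)
      ultimately show ?thesis by (simp add: inner)
    qed
  qed
  then have "AE x in M. h x = 0"
    using spectrum by (intro L2_orthogonal_basis_complete[OF _ h]) (auto simp: spectrum_of_def)
  then obtain x where "x \<in> {\<alpha> $ i<..<\<beta> $ i}" "h x = 0"
    using interval_subset_Omega ordered_intervals_less[OF ordered]
    by (rule AE_lebesgue_on_interval_witness[OF _ Omega_sets])
  then show ?thesis by (simp add: h_eq)
qed

section \<open>The permutation is a single cycle\<close>

text \<open>Otherwise the constant function 1 would be orthogonal to an empty basis, hence zero
  almost everywhere.\<close>

lemma spectrum_nonempty: "\<Lambda> \<noteq> {}"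
proof
  assume "\<Lambda> = {}"
  then have "AE x in M. e_fun 0 x = 0"
    using spectrum by (intro L2_orthogonal_basis_complete[OF _ e_fun_L2]) (auto simp: spectrum_of_def)
  then obtain x where "x \<in> {\<alpha> $ undefined<..<\<beta> $ undefined}" "e_fun 0 x = 0"
    using interval_subset_Omega ordered_intervals_less[OF ordered]
    by (rule AE_lebesgue_on_interval_witness[OF _ Omega_sets])
  then show False by simp
qed

text \<open>At a frequency \<mu> of \<Lambda>, any \<sigma>-invariant coefficients satisfy the
  boundary condition. The indicator of \<open>C\<close> minus its length-weighted average \<kappa>
  also has mean zero, so it vanishes: \<kappa> equals every value of the indicator, which is
  therefore constant.\<close>

lemma invariant_eq_UNIV:
  assumes C: "C \<noteq> {}" "\<And>i. \<sigma> i \<in> C \<longleftrightarrow> i \<in> C"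
  shows "C = UNIV"
proof -
  obtain \<mu> where \<mu>: "\<mu> \<in> \<Lambda>" using spectrum_nonempty by blast
  define \<kappa> where "\<kappa> = (\<Sum>i\<in>C. len i) / L"
  have "(if i \<in> C then 1 else 0) - complex_of_real \<kappa> = 0" for i
  proof (rule boundary_solution_zero)
    show "((if i \<in> C then 1 else 0) - complex_of_real \<kappa>) * e_fun \<mu> (\<beta> $ i) =
        B $ i $ \<sigma> i * ((if \<sigma> i \<in> C then 1 else 0) - complex_of_real \<kappa>) * e_fun \<mu> (\<alpha> $ \<sigma> i)" for i
      by (simp add: C(2) e_fun_boundary[OF \<mu>])
    have "(\<Sum>i\<in>UNIV. ((if i \<in> C then 1 else 0) - \<kappa>) * len i) = (\<Sum>i\<in>UNIV. if i \<in> C then len i else 0) - \<kappa> * L"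
      unfolding L_def sum_distrib_left sum_subtractf[symmetric]
      by (intro sum.cong refl) (simp add: left_diff_distrib)
    also have "\<dots> = 0"
      using L_pos by (simp add: \<kappa>_def sum.If_cases)
    finally have "complex_of_real (\<Sum>i\<in>UNIV. ((if i \<in> C then 1 else 0) - \<kappa>) * len i) = 0" by simp
    also have "complex_of_real (\<Sum>i\<in>UNIV. ((if i \<in> C then 1 else 0) - \<kappa>) * len i)
        = (\<Sum>i\<in>UNIV. ((if i \<in> C then 1 else 0) - complex_of_real \<kappa>) * of_real (len i))"
      unfolding of_real_sum by (intro sum.cong refl) simp
    finally show "(\<Sum>i\<in>UNIV. ((if i \<in> C then 1 else 0) - complex_of_real \<kappa>) * of_real (len i)) = 0" .
  qed
  then have "complex_of_real \<kappa> = (if i \<in> C then 1 else 0)" for i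
    by (metis right_minus_eq)
  then show ?thesis using C(1)
    by (metis UNIV_eq_I equals0I zero_neq_one)
qed

text \<open>Every orbit of \<sigma> is nonempty and invariant under \<sigma> in both directions, so
  \<open>invariant_eq_UNIV\<close> applies.\<close>

lemma cyclic: "cyclic_on \<sigma> UNIV"
proof -
  have perm: "permutation \<sigma>" using permutes by (auto simp: permutation_permutes)
  have "orbit \<sigma> x = UNIV" for x
  proof (rule invariant_eq_UNIV)
    show "orbit \<sigma> x \<noteq> {}" by (auto intro: orbit.base)
    show "\<sigma> i \<in> orbit \<sigma> x \<longleftrightarrow> i \<in> orbit \<sigma> x" for i
      using permutation_orbit_step[OF perm] by (metis orbit.step orbit_swap orbit_trans permutation_self_in_orbit[OF perm] orbit.base)
  qed
  then show ?thesis by (auto simp: cyclic_on_def)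
qed

text \<open>The weights cancel between \<mu> and \<nu>, so \<open>e_fun (\<mu> - \<nu>)\<close>
  agrees at \<beta>_i and at the left end of interval \<sigma>(i). In the product over i the
  permutation disappears, and the differences \<beta>_i - \<alpha>_i add up to L.\<close>

lemma spectrum_difference:
  assumes "\<mu> \<in> \<Lambda>" "\<nu> \<in> \<Lambda>" shows "(\<mu> - \<nu>) * L \<in> \<int>"
proof -
  have "e_fun (\<mu> - \<nu>) (\<beta> $ i) = e_fun (\<mu> - \<nu>) (\<alpha> $ \<sigma> i)" for i
  proof -
    have "e_fun (\<mu> - \<nu>) (\<beta> $ i) = (B $ i $ \<sigma> i * cnj (B $ i $ \<sigma> i)) *
        (e_fun \<mu> (\<alpha> $ \<sigma> i) * cnj (e_fun \<nu> (\<alpha> $ \<sigma> i)))"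
      unfolding e_fun_diff_freq assms[THEN e_fun_boundary] by (simp add: mult_ac)
    then show ?thesis by (simp add: weight_mult_cnj e_fun_diff_freq)
  qed
  then have "(\<Prod>i\<in>UNIV. e_fun (\<mu> - \<nu>) (\<beta> $ i)) = (\<Prod>i\<in>UNIV. e_fun (\<mu> - \<nu>) (\<alpha> $ i))"
    by (simp add: prod_permute[of "\<lambda>i. e_fun (\<mu> - \<nu>) (\<alpha> $ i)"])
  then have "e_fun (\<mu> - \<nu>) (\<Sum>i\<in>UNIV. \<beta> $ i) = e_fun (\<mu> - \<nu>) (\<Sum>i\<in>UNIV. \<alpha> $ i)"
    by (simp add: e_fun_sum)
  moreover have "(\<Sum>i\<in>UNIV. \<beta> $ i) = L + (\<Sum>i\<in>UNIV. \<alpha> $ i)"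
    by (simp add: L_def len_def sum_subtractf)
  ultimately have "e_fun (\<mu> - \<nu>) L = 1"
    by (simp add: e_fun_add)
  then show ?thesis by (simp add: e_fun_eq_1_iff)
qed

section \<open>Laying the intervals end to end along the cycle\<close>

abbreviation first :: 'n where "first \<equiv> Min UNIV"
abbreviation it where "it \<equiv> itinerary \<sigma>"
abbreviation \<tau> where "\<tau> \<equiv> cycle_shift \<alpha> \<beta> \<sigma>"

text \<open>The left end of the k-th cell when the intervals are laid end to end from \<alpha>_1 in
  the order of the cycle.\<close>

definition pos where "pos k = \<alpha> $ first + (\<Sum>j<k. len (it j))"

lemma itinerary_Suc: "it (Suc k) = \<sigma> (it k)"
  by (simp add: itinerary_def)

text \<open>Up to its first return time \<open>m\<close>, the orbit of the first index is traversed
  injectively and covers all indices, so m = n.\<close>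

lemma itinerary_bij: "bij_betw it {..<CARD('n)} UNIV"
  and itinerary_card: "it (CARD('n)) = first"
proof -
  have perm: "permutation \<sigma>" using permutes by (auto simp: permutation_permutes)
  define m where "m = funpow_dist1 \<sigma> first first"
  have self: "first \<in> orbit \<sigma> first"
    by (rule permutation_self_in_orbit[OF perm])
  have "orbit \<sigma> first = UNIV"
    using cyclic by (simp add: orbit_cyclic_eq3)
  then have image: "it ` {..<m} = UNIV"
    using orbit_conv_funpow_dist1[OF self] by (simp add: m_def itinerary_def[abs_def] atLeast0LessThan)
  moreover have inj: "inj_on it {..<m}"
    using inj_on_funpow_dist1[OF self] by (simp add: m_def itinerary_def[abs_def] atLeast0LessThan)
  ultimately have "m = CARD('n)"
    using card_image[of it "{..<m}"] by simp
  moreover have "it m = first"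
    using funpow_dist1_prop[OF self] by (simp add: m_def itinerary_def)
  ultimately show "bij_betw it {..<CARD('n)} UNIV" "it (CARD('n)) = first"
    using image inj by (simp_all add: bij_betw_def)
qed

lemma pos_Suc: "pos (Suc k) = pos k + len (it k)"
  by (simp add: pos_def)

text \<open>Telescoping: each new term of \<tau> moves the left end of the next interval onto the
  right end of the current one.\<close>

lemma shift_left: "\<tau> k + \<alpha> $ it k = pos k"
proof (induction k)
  case 0
  then show ?case by (simp add: cycle_shift_def pos_def itinerary_def)
next
  case (Suc k)
  have "\<tau> (Suc k) = \<tau> k + (\<beta> $ it k - \<alpha> $ it (Suc k))"
    by (simp add: cycle_shift_def)
  then show ?case using Suc by (simp add: pos_Suc len_def)
qed

lemma shift_right: "\<tau> k + \<beta> $ it k = pos (Suc k)"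
  using shift_left[of k] by (simp add: pos_Suc len_def)

lemma pos_card: "pos (CARD('n)) = \<alpha> $ first + L"
  using sum.reindex_bij_betw[OF itinerary_bij, of len] by (simp add: pos_def L_def)

text \<open>After n steps the cycle is back at its first interval, now placed one full length L
  further on. This closes the wrap-around step in \<open>spectrum_complete\<close>.\<close>

lemma shift_card: "\<tau> (CARD('n)) = L"
  using shift_left[of "CARD('n)"] by (simp add: pos_card itinerary_card)

section \<open>Lattice structure of the spectrum and of the gaps\<close>

text \<open>The coefficients exp(2 pi i (\<nu> - \<mu>) \<tau>_k) along the cycle turn the weights,
  known from \<mu>, into the boundary condition for \<nu>. If \<nu> were outside \<Lambda>,
  \<open>boundary_solution_zero\<close> would annihilate these unimodular numbers.\<close>

lemma spectrum_complete:
  assumes "\<mu> \<in> \<Lambda>" "(\<nu> - \<mu>) * L \<in> \<int>" shows "\<nu> \<in> \<Lambda>"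
proof (rule ccontr)
  assume "\<nu> \<notin> \<Lambda>"
  let ?\<delta> = "\<nu> - \<mu>"
  define ix where "ix = inv_into {..<CARD('n)} it"
  have ix: "ix i < CARD('n)" "it (ix i) = i" for i
    using bij_betw_inv_into_right[OF itinerary_bij, of i]
      bij_betwE[OF bij_betw_inv_into[OF itinerary_bij]] by (auto simp: ix_def)
  have ix_it: "ix (it k) = k" if "k < CARD('n)" for k
    using bij_betw_inv_into_left[OF itinerary_bij, of k] that by (simp add: ix_def)
  define c where "c i = e_fun ?\<delta> (\<tau> (ix i))" for i
  have step: "c (\<sigma> i) = e_fun ?\<delta> (\<tau> (Suc (ix i)))" for i
  proof (cases "Suc (ix i) < CARD('n)")
    case True
    have "\<sigma> i = it (Suc (ix i))" by (simp add: itinerary_Suc ix)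
    then show ?thesis using ix_it[OF True] by (simp add: c_def)
  next
    \<comment> \<open>The wrap-around: \<sigma>(i) is the first index, with \<open>ix\<close> equal
      to 0 rather than n. The coefficients still match because \<tau>_n = L and (\<nu> - \<mu>)L is
      an integer.\<close>
    case False
    then have last: "Suc (ix i) = CARD('n)" using ix(1)[of i] by simp
    have "\<sigma> i = it (Suc (ix i))" by (simp add: itinerary_Suc ix)
    also have "\<dots> = it 0" unfolding last itinerary_card by (simp add: itinerary_def)
    finally have "ix (\<sigma> i) = 0" using ix_it[of 0] by simp
    then show ?thesis
      using assms(2) unfolding last shift_card by (simp add: c_def cycle_shift_def e_fun_eq_1_iff)
  qed
  have "c i = 0" for i
  proof (rule boundary_solution_zero)
    show "c i * e_fun \<nu> (\<beta> $ i) = B $ i $ \<sigma> i * c (\<sigma> i) * e_fun \<nu> (\<alpha> $ \<sigma> i)" for i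
    proof -
      have "\<tau> (Suc (ix i)) = \<tau> (ix i) + (\<beta> $ i - \<alpha> $ \<sigma> i)"
        by (simp add: cycle_shift_def itinerary_Suc ix)
      then have "c (\<sigma> i) = c i * e_fun ?\<delta> (\<beta> $ i - \<alpha> $ \<sigma> i)"
        by (simp add: step e_fun_add) (simp add: c_def)
      then have "B $ i $ \<sigma> i * c (\<sigma> i) * e_fun \<nu> (\<alpha> $ \<sigma> i)
          = c i * (e_fun (\<mu> + ?\<delta>) (\<beta> $ i - \<alpha> $ \<sigma> i) * e_fun \<nu> (\<alpha> $ \<sigma> i))"
        unfolding weight_eq[OF assms(1)] e_fun_add_freq by (simp add: mult_ac)
      also have "\<dots> = c i * e_fun \<nu> (\<beta> $ i)"
        by (simp flip: e_fun_add)
      finally show ?thesis ..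
    qed
  qed (use \<open>\<nu> \<notin> \<Lambda>\<close> in simp)
  then show False by (simp add: c_def)
qed

text \<open>Both \<mu> and \<mu> + 1/L lie in \<Lambda> and determine the same matrix entry through
  \<open>weight_eq\<close>; the quotient of the two expressions is \<open>e_fun (1 / L)\<close> at
  the negated gap, hence equal to 1.\<close>

lemma gap_in_lattice: "\<alpha> $ \<sigma> i - \<beta> $ i \<in> (\<lambda>m. L * m) ` \<int>"
proof -
  obtain \<mu> where \<mu>: "\<mu> \<in> \<Lambda>" using spectrum_nonempty by blast
  have \<nu>: "\<mu> + 1 / L \<in> \<Lambda>"
    using L_pos by (intro spectrum_complete[OF \<mu>]) simp
  have "e_fun (\<mu> + 1 / L) (\<beta> $ i - \<alpha> $ \<sigma> i) = e_fun \<mu> (\<beta> $ i - \<alpha> $ \<sigma> i)"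
    using weight_eq[OF \<mu>, of i] weight_eq[OF \<nu>, of i] by simp
  then have "e_fun (1 / L) (\<beta> $ i - \<alpha> $ \<sigma> i) = 1"
    by (simp add: e_fun_add_freq)
  then have "- (1 / L * (\<beta> $ i - \<alpha> $ \<sigma> i)) \<in> \<int>"
    unfolding e_fun_eq_1_iff by (rule Ints_minus)
  moreover have "\<alpha> $ \<sigma> i - \<beta> $ i = L * (- (1 / L * (\<beta> $ i - \<alpha> $ \<sigma> i)))"
    using L_pos by (simp add: field_simps)
  ultimately show ?thesis by blast
qed

text \<open>Each term of \<tau>_k is the negative of a gap
  \<open>\<alpha> $ \<sigma> i - \<beta> $ i\<close>.\<close>

lemma shift_in_lattice: "\<exists>m :: int. of_int m * L = \<tau> k"
proof (induction k)
  case 0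
  then show ?case by (simp add: cycle_shift_def)
next
  case (Suc k)
  then obtain m :: int where m: "of_int m * L = \<tau> k" by blast
  obtain l :: int where l: "\<alpha> $ \<sigma> (it k) - \<beta> $ it k = L * of_int l"
    using gap_in_lattice[of "it k"] by (auto elim!: Ints_cases)
  have "\<tau> (Suc k) = \<tau> k + (\<beta> $ it k - \<alpha> $ \<sigma> (it k))"
    by (simp add: cycle_shift_def itinerary_Suc)
  then have "of_int (m - l) * L = \<tau> (Suc k)"
    using l m by (simp add: algebra_simps)
  then show ?case by blast
qed

lemma pos_0: "pos 0 = \<alpha> $ first"
  by (simp add: pos_def)

lemma pos_strict_mono: "strict_mono pos"
  by (rule strict_monoI_Suc) (simp add: pos_Suc len_pos)

lemma translate_interval: "(+) (\<tau> k) ` {\<alpha> $ it k<..<\<beta> $ it k} = {pos k<..<pos (Suc k)}"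
proof (intro equalityI subsetI)
  fix x assume "x \<in> {pos k<..<pos (Suc k)}"
  then have "x - \<tau> k \<in> {\<alpha> $ it k<..<\<beta> $ it k}"
    using shift_left[of k] shift_right[of k] by auto
  then have "\<tau> k + (x - \<tau> k) \<in> (+) (\<tau> k) ` {\<alpha> $ it k<..<\<beta> $ it k}" by (rule imageI)
  then show "x \<in> (+) (\<tau> k) ` {\<alpha> $ it k<..<\<beta> $ it k}" by simp
qed (use shift_left[of k] shift_right[of k] in auto)

text \<open>Half-open cells abut without losing a point, so this union is exact; the translated
  intervals miss only the left ends.\<close>

lemma Union_pos: "(\<Union>k<m. {pos k..<pos (Suc k)}) = {pos 0..<pos m}"
proof (induction m)
  case (Suc m)
  have "pos 0 \<le> pos m" "pos m \<le> pos (Suc m)"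
    using strict_mono_less_eq[OF pos_strict_mono] by auto
  then show ?case using Suc by (auto simp: lessThan_Suc)
qed simp

lemma pos_cell_unique:
  assumes "x \<in> {pos k..<pos (Suc k)}" "x \<in> {pos l..<pos (Suc l)}"
  shows "k = l"
proof -
  have "pos k < pos (Suc l)" "pos l < pos (Suc k)" using assms by auto
  then show ?thesis
    unfolding strict_mono_less[OF pos_strict_mono] by simp
qed

lemma Omega_itinerary: "(\<Union>k<CARD('n). {\<alpha> $ it k<..<\<beta> $ it k}) = Omega \<alpha> \<beta>"
proof -
  have "(\<Union>k<CARD('n). {\<alpha> $ it k<..<\<beta> $ it k}) = (\<Union>i\<in>it ` {..<CARD('n)}. {\<alpha> $ i<..<\<beta> $ i})"
    by blast
  also have "it ` {..<CARD('n)} = UNIV"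
    using itinerary_bij by (simp add: bij_betw_def)
  finally show ?thesis by (simp add: Omega_def)
qed

lemma Omega_itineraryE:
  assumes "x \<in> Omega \<alpha> \<beta>"
  obtains k where "k < CARD('n)" "x \<in> {\<alpha> $ it k<..<\<beta> $ it k}" "\<tau> k + x \<in> {pos k<..<pos (Suc k)}"
proof -
  obtain k where k: "k < CARD('n)" "x \<in> {\<alpha> $ it k<..<\<beta> $ it k}"
    using assms unfolding Omega_itinerary[symmetric] by blast
  then have "\<tau> k + x \<in> {pos k<..<pos (Suc k)}"
    unfolding translate_interval[symmetric] by blast
  with k show ?thesis using that by blast
qed

section \<open>Tiling and translation congruence\<close>

lemma fundamental_domain_unique:
  fixes m :: int
  assumes "x \<in> {\<alpha> $ first..<\<alpha> $ first + L}" "x + of_int m * L \<in> {\<alpha> $ first..<\<alpha> $ first + L}"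
  shows "m = 0"
proof -
  have "of_int m * L < 1 * L" "(- 1) * L < of_int m * L"
    using assms unfolding atLeastLessThan_iff by linarith+
  then have "of_int m < (1 :: real)" "- 1 < (of_int m :: real)"
    using L_pos mult_less_cancel_right_pos by blast+
  then show ?thesis by linarith
qed

lemma pos_cell_subset:
  assumes "k < CARD('n)" shows "{pos k<..<pos (Suc k)} \<subseteq> {\<alpha> $ first..<\<alpha> $ first + L}"
proof -
  have "{pos k..<pos (Suc k)} \<subseteq> {pos 0..<pos (CARD('n))}"
    unfolding Union_pos[symmetric] using assms by blast
  then show ?thesis unfolding pos_0 pos_card by force
qed

text \<open>Modulo L the set \<open>Omega\<close> fills the fundamental domain [\<alpha>_1,
  \<alpha>_1 + L) cell by cell, except for the left ends. Uncovered points thus lie among the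
  countably many translates of the numbers \<open>pos k\<close>, and distinct translates are even
  disjoint.\<close>

lemma tiles_lattice: "tiles (Omega \<alpha> \<beta>) ((\<lambda>m. L * m) ` \<int>)"
  unfolding tiles_def
proof (intro conjI ballI impI)
  let ?N = "(\<lambda>(k, m :: int). pos k + of_int m * L) ` UNIV"
  have "negligible ?N"
    unfolding negligible_iff_null_sets
    by (intro null_sets_completionI countable_imp_null_set_lborel countable_image) simp
  moreover have "UNIV - (\<Union>t\<in>(\<lambda>m. L * m) ` \<int>. (+) t ` Omega \<alpha> \<beta>) \<subseteq> ?N"
  proof
    fix x assume x: "x \<in> UNIV - (\<Union>t\<in>(\<lambda>m. L * m) ` \<int>. (+) t ` Omega \<alpha> \<beta>)"
    \<comment> \<open>The multiple of L that brings x back to y in the fundamental domain.\<close>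
    define m where "m = \<lfloor>(x - \<alpha> $ first) / L\<rfloor>"
    define y where "y = x - of_int m * L"
    have "of_int m \<le> (x - \<alpha> $ first) / L" "(x - \<alpha> $ first) / L < of_int m + 1"
      by (simp_all add: m_def)
    then have "y \<in> {pos 0..<pos (CARD('n))}"
      using L_pos unfolding pos_0 pos_card by (simp add: y_def field_simps)
    then obtain k where k: "k < CARD('n)" "y \<in> {pos k..<pos (Suc k)}"
      unfolding Union_pos[symmetric] by blast
    show "x \<in> ?N"
    proof (cases "y = pos k")
      case True
      then show ?thesis by (auto simp: y_def intro!: image_eqI[of _ _ "(k, m)"])
    next
      case False
      then have "y \<in> (+) (\<tau> k) ` {\<alpha> $ it k<..<\<beta> $ it k}"
        using k unfolding translate_interval by auto
      then obtain z where z: "z \<in> Omega \<alpha> \<beta>" "y = \<tau> k + z"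
        using interval_subset_Omega[of \<alpha> "it k" \<beta>] by blast
      obtain l :: int where l: "of_int l * L = \<tau> k" using shift_in_lattice by blast
      have "x = L * of_int (m + l) + z"
        using z(2) l by (simp add: y_def algebra_simps)
      then have "x \<in> (+) (L * of_int (m + l)) ` Omega \<alpha> \<beta>"
        using z(1) by simp
      moreover have "L * of_int (m + l) \<in> (\<lambda>m. L * m) ` \<int>"
        by (intro imageI Ints_of_int)
      ultimately show ?thesis using x by blast
    qed
  qed
  ultimately show "negligible (UNIV - (\<Union>t\<in>(\<lambda>m. L * m) ` \<int>. (+) t ` Omega \<alpha> \<beta>))"
    by (rule negligible_subset)
next
  fix s t assume "s \<in> (\<lambda>m. L * m) ` \<int>" "t \<in> (\<lambda>m. L * m) ` \<int>" and "s \<noteq> t"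
  then obtain a b :: int where ab: "s = L * of_int a" "t = L * of_int b"
    by (auto elim!: Ints_cases)
  have "(+) s ` Omega \<alpha> \<beta> \<inter> (+) t ` Omega \<alpha> \<beta> = {}"
  proof (rule ccontr)
    assume "(+) s ` Omega \<alpha> \<beta> \<inter> (+) t ` Omega \<alpha> \<beta> \<noteq> {}"
    then obtain x y where xy: "x \<in> Omega \<alpha> \<beta>" "y \<in> Omega \<alpha> \<beta>" "s + x = t + y" by auto
    obtain k where k: "k < CARD('n)" "x \<in> {\<alpha> $ it k<..<\<beta> $ it k}" "\<tau> k + x \<in> {pos k<..<pos (Suc k)}"
      using xy(1) by (rule Omega_itineraryE)
    obtain l where l: "l < CARD('n)" "y \<in> {\<alpha> $ it l<..<\<beta> $ it l}" "\<tau> l + y \<in> {pos l<..<pos (Suc l)}"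
      using xy(2) by (rule Omega_itineraryE)
    obtain p :: int where p: "of_int p * L = \<tau> k" using shift_in_lattice by blast
    obtain q :: int where q: "of_int q * L = \<tau> l" using shift_in_lattice by blast
    \<comment> \<open>Both \<tau>_l + y and \<tau>_k + x lie in the fundamental domain and differ by
      a multiple of L, so they coincide and belong to the same cell.\<close>
    have eq: "\<tau> l + y = (\<tau> k + x) + of_int (a - b + q - p) * L"
      using xy(3) by (simp add: ab algebra_simps flip: p q)
    then have "a - b + q - p = 0"
      using k l pos_cell_subset[of k] pos_cell_subset[of l]
      by (intro fundamental_domain_unique[of "\<tau> k + x"]) auto
    then have same: "\<tau> l + y = \<tau> k + x" using eq by simp
    then have "k = l"
      using k(3) l(3) by (intro pos_cell_unique[of "\<tau> k + x"]) auto
    then show False using same xy(3) \<open>s \<noteq> t\<close> by simp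
  qed
  then show "negligible ((+) s ` Omega \<alpha> \<beta> \<inter> (+) t ` Omega \<alpha> \<beta>)" by simp
qed

text \<open>Away from the break points \<open>pos 0\<close>, ..., \<open>pos n\<close>, open and
  half-open cells contain the same points.\<close>

lemma finite_missing:
  "finite (sym_diff (\<Union>k<CARD('n). (+) (\<tau> k) ` {\<alpha> $ it k<..<\<beta> $ it k}) {\<alpha> $ first<..<\<alpha> $ first + L})"
proof (rule finite_subset)
  show "sym_diff (\<Union>k<CARD('n). (+) (\<tau> k) ` {\<alpha> $ it k<..<\<beta> $ it k}) {\<alpha> $ first<..<\<alpha> $ first + L}
      \<subseteq> pos ` {..CARD('n)}"
  proof
    fix x
    assume x: "x \<in> sym_diff (\<Union>k<CARD('n). (+) (\<tau> k) ` {\<alpha> $ it k<..<\<beta> $ it k}) {\<alpha> $ first<..<\<alpha> $ first + L}"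
    have "x \<in> {\<alpha> $ first<..<\<alpha> $ first + L} \<longleftrightarrow> x \<noteq> pos 0 \<and> x \<in> {pos 0..<pos (CARD('n))}"
      unfolding pos_card by (auto simp: pos_0)
    also have "\<dots> \<longleftrightarrow> x \<noteq> pos 0 \<and> (\<exists>k<CARD('n). x \<in> {pos k..<pos (Suc k)})"
      unfolding Union_pos[symmetric] by blast
    finally have 1: "x \<in> {\<alpha> $ first<..<\<alpha> $ first + L}
        \<longleftrightarrow> x \<noteq> pos 0 \<and> (\<exists>k<CARD('n). x \<in> {pos k..<pos (Suc k)})" .
    have 2: "x \<in> (\<Union>k<CARD('n). (+) (\<tau> k) ` {\<alpha> $ it k<..<\<beta> $ it k})
        \<longleftrightarrow> (\<exists>k<CARD('n). x \<in> {pos k<..<pos (Suc k)})"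
      unfolding translate_interval by blast
    show "x \<in> pos ` {..CARD('n)}"
    proof (rule ccontr)
      assume no: "x \<notin> pos ` {..CARD('n)}"
      then have "x \<in> {pos k<..<pos (Suc k)} \<longleftrightarrow> x \<in> {pos k..<pos (Suc k)}" if "k < CARD('n)" for k
        using that by (auto simp: less_le)
      moreover have "x \<noteq> pos 0" using no by auto
      ultimately show False using x 1 2 by blast
    qed
  qed
qed simp

text \<open>\<open>measurable_partition\<close> asks for exact partitions, so each target piece
  keeps its left end, apart from \<alpha>_1, which lies outside the open interval. A translated
  interval then differs from its piece in at most the point \<open>pos k\<close>.\<close>

lemma translation_congruence_itinerary:
  assumes m: "\<And>k. k < CARD('n) \<Longrightarrow> of_int (m k) * L = \<tau> k"
  shows "translation_congruence L (Omega \<alpha> \<beta>) {\<alpha> $ first<..<\<alpha> $ first + L} {..<CARD('n)}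
    (\<lambda>k. {\<alpha> $ it k<..<\<beta> $ it k}) (\<lambda>k. {pos k..<pos (Suc k)} - {\<alpha> $ first}) m"
  unfolding translation_congruence_def measurable_partition_def
proof (intro conjI ballI)
  show "disjoint_family_on (\<lambda>k. {\<alpha> $ it k<..<\<beta> $ it k}) {..<CARD('n)}"
    unfolding disjoint_family_on_def
  proof (intro ballI impI)
    fix k l assume "k \<in> {..<CARD('n)}" "l \<in> {..<CARD('n)}" "k \<noteq> l"
    then have "it k \<noteq> it l"
      using inj_onD[OF bij_betw_imp_inj_on[OF itinerary_bij]] by blast
    then show "{\<alpha> $ it k<..<\<beta> $ it k} \<inter> {\<alpha> $ it l<..<\<beta> $ it l} = {}"
      using ordered_intervals_unique[OF ordered] by blast
  qed
  show "(\<Union>k<CARD('n). {\<alpha> $ it k<..<\<beta> $ it k}) = Omega \<alpha> \<beta>"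
    by (rule Omega_itinerary)
  show "disjoint_family_on (\<lambda>k. {pos k..<pos (Suc k)} - {\<alpha> $ first}) {..<CARD('n)}"
    unfolding disjoint_family_on_def
  proof (intro ballI impI)
    fix k l :: nat assume "k \<noteq> l"
    then show "({pos k..<pos (Suc k)} - {\<alpha> $ first}) \<inter> ({pos l..<pos (Suc l)} - {\<alpha> $ first}) = {}"
      using pos_cell_unique[of _ k l] by blast
  qed
  have "(\<Union>k<CARD('n). {pos k..<pos (Suc k)} - {\<alpha> $ first}) = {pos 0..<pos (CARD('n))} - {\<alpha> $ first}"
    unfolding Union_pos[symmetric] by blast
  also have "\<dots> = {\<alpha> $ first<..<\<alpha> $ first + L}"
    unfolding pos_card pos_0 by auto
  finally show "(\<Union>k<CARD('n). {pos k..<pos (Suc k)} - {\<alpha> $ first}) = {\<alpha> $ first<..<\<alpha> $ first + L}" .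
  fix k assume "k \<in> {..<CARD('n)}"
  then have "(+) (of_int (m k) * L) ` {\<alpha> $ it k<..<\<beta> $ it k} = {pos k<..<pos (Suc k)}"
    using m translate_interval by simp
  moreover have "sym_diff {pos k<..<pos (Suc k)} ({pos k..<pos (Suc k)} - {\<alpha> $ first}) \<subseteq> {pos k, \<alpha> $ first}"
    by auto
  ultimately show "negligible (sym_diff ((+) (of_int (m k) * L) ` {\<alpha> $ it k<..<\<beta> $ it k})
      ({pos k..<pos (Suc k)} - {\<alpha> $ first}))"
    using negligible_subset[OF negligible_finite[of "{pos k, \<alpha> $ first}"]] by simp
qed auto

section \<open>The phase and the final statement\<close>

text \<open>Any \<mu> in \<Lambda> provides a phase \<theta>_0 = - \<mu> L, because (m -
  \<theta>_0)/L = \<mu> + m/L; the two inclusions are \<open>spectrum_difference\<close> and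
  \<open>spectrum_complete\<close>.\<close>

lemma spectrum_eq:
  assumes "\<mu> \<in> \<Lambda>" shows "\<Lambda> = (\<lambda>m. 1 / L * (m - (- \<mu> * L))) ` \<int>"
proof (intro equalityI subsetI)
  fix \<nu> assume "\<nu> \<in> \<Lambda>"
  then have "(\<nu> - \<mu>) * L \<in> \<int>" using assms by (rule spectrum_difference)
  moreover have "\<nu> = 1 / L * ((\<nu> - \<mu>) * L - (- \<mu> * L))"
    using L_pos by (simp add: field_simps)
  ultimately show "\<nu> \<in> (\<lambda>m. 1 / L * (m - (- \<mu> * L))) ` \<int>" by blast
next
  fix \<nu> assume "\<nu> \<in> (\<lambda>m. 1 / L * (m - (- \<mu> * L))) ` \<int>"
  then show "\<nu> \<in> \<Lambda>"
    using L_pos by (intro spectrum_complete[OF assms]) (auto simp: field_simps)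
qed

lemma weight_phase:
  assumes "\<mu> \<in> \<Lambda>"
  shows "B $ i $ \<sigma> i = exp (2 * of_real pi * \<i> * of_real ((- \<mu> * L) / L * (\<alpha> $ \<sigma> i - \<beta> $ i)))"
proof -
  have "(- \<mu> * L) / L * (\<alpha> $ \<sigma> i - \<beta> $ i) = \<mu> * (\<beta> $ i - \<alpha> $ \<sigma> i)"
    using L_pos by (simp add: field_simps)
  then show ?thesis
    unfolding weight_eq[OF assms] e_fun_def by (simp add: mult.assoc)
qed

end

theorem theorem4p14:
  fixes \<alpha> \<beta> :: "real ^ ('n :: {finite, linorder})"
    and \<Lambda> :: "real set"
    and B :: "complex ^ ('n :: {finite, linorder}) ^ ('n :: {finite, linorder})"
    and U :: "real \<Rightarrow> (real \<Rightarrow> complex) \<Rightarrow> real \<Rightarrow> complex"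
    and L :: real
  assumes "ordered_intervals \<alpha> \<beta>"
    and "spectrum_of (Omega \<alpha> \<beta>) \<Lambda>"
    and "boundary_matrix \<alpha> \<beta> \<Lambda> B"
    and "exp_group (lebesgue_on (Omega \<alpha> \<beta>)) (D_op \<alpha> \<beta> B) U"
    and "forelli (lebesgue_on (Omega \<alpha> \<beta>)) U"
    and "L = measure lebesgue (Omega \<alpha> \<beta>)"
  shows "\<exists>\<sigma> (\<theta>0 :: real).
    (\<sigma> permutes UNIV \<and> cyclic_on \<sigma> UNIV \<and>
     weighted_permutation_matrix B \<sigma> \<and>
     (\<forall>i. B $ i $ \<sigma> i =
        exp (2 * of_real pi * \<i> * of_real (\<theta>0 / L * (\<alpha> $ \<sigma> i - \<beta> $ i)))))
    \<and>
    (\<forall>i. \<alpha> $ \<sigma> i - \<beta> $ i \<in> (\<lambda>m. L * m) ` \<int>)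
    \<and>
    (\<Lambda> = (\<lambda>m. 1 / L * (m - \<theta>0)) ` \<int> \<and>
     tiles (Omega \<alpha> \<beta>) ((\<lambda>m. L * m) ` \<int>))
    \<and>
    ((\<forall>k\<in>{1..CARD('n) - 1}.
        (+) (cycle_shift \<alpha> \<beta> \<sigma> k) ` {\<alpha> $ itinerary \<sigma> k <..< \<beta> $ itinerary \<sigma> k} =
        {\<alpha> $ Min UNIV + (\<Sum>j\<in>{0..k - 1}. \<beta> $ itinerary \<sigma> j - \<alpha> $ itinerary \<sigma> j) <..<
         \<alpha> $ Min UNIV + (\<Sum>j\<in>{0..k}. \<beta> $ itinerary \<sigma> j - \<alpha> $ itinerary \<sigma> j)}) \<and>
     finite (sym_diff
       ({\<alpha> $ Min UNIV <..< \<beta> $ Min UNIV} \<union>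
        (\<Union>k\<in>{1..CARD('n) - 1}.
           (+) (cycle_shift \<alpha> \<beta> \<sigma> k) ` {\<alpha> $ itinerary \<sigma> k <..< \<beta> $ itinerary \<sigma> k}))
       {\<alpha> $ Min UNIV <..< \<alpha> $ Min UNIV + L}) \<and>
     (\<forall>k\<in>{1..CARD('n) - 1}. cycle_shift \<alpha> \<beta> \<sigma> k \<in> (\<lambda>m. L * m) ` \<int>) \<and>
     (\<exists>P' m.
        (\<forall>k<CARD('n). of_int (m k) * L = cycle_shift \<alpha> \<beta> \<sigma> k) \<and>
        translation_congruence L (Omega \<alpha> \<beta>) {\<alpha> $ Min UNIV <..< \<alpha> $ Min UNIV + L}
          {..<CARD('n)} (\<lambda>k. {\<alpha> $ itinerary \<sigma> k <..< \<beta> $ itinerary \<sigma> k}) P' m) \<and>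
     translation_congruent L (Omega \<alpha> \<beta>) {\<alpha> $ Min UNIV <..< \<alpha> $ Min UNIV + L})"
proof -
  interpret spectral_group \<alpha> \<beta> \<Lambda> B U
    by unfold_locales (use assms in auto)
  obtain \<sigma> where \<sigma>: "\<sigma> permutes UNIV" "weighted_permutation_matrix B \<sigma>"
    by (rule unitary_matrix_weighted_permutation[OF unitary_B]) (rule forelli_boundary_row[OF assms(5)])
  interpret W: weighted_union \<alpha> \<beta> \<Lambda> B \<sigma>
    by unfold_locales (use \<sigma> in auto)
  have L: "W.L = L"
    unfolding assms(6) measure_Omega[OF ordered] by (simp add: W.L_def W.len_def)
  obtain \<mu> where \<mu>: "\<mu> \<in> \<Lambda>" using W.spectrum_nonempty by blast
  obtain m :: "nat \<Rightarrow> int" where m: "\<And>k. of_int (m k) * L = cycle_shift \<alpha> \<beta> \<sigma> k"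
    using W.shift_in_lattice unfolding L by metis
  have congruence: "translation_congruence L (Omega \<alpha> \<beta>) {\<alpha> $ Min UNIV<..<\<alpha> $ Min UNIV + L} {..<CARD('n)}
      (\<lambda>k. {\<alpha> $ itinerary \<sigma> k<..<\<beta> $ itinerary \<sigma> k}) (\<lambda>k. {W.pos k..<W.pos (Suc k)} - {\<alpha> $ Min UNIV}) m"
    using W.translation_congruence_itinerary[of m] m unfolding L by blast
  have cells: "{\<alpha> $ Min UNIV + (\<Sum>j\<in>{0..k - 1}. \<beta> $ itinerary \<sigma> j - \<alpha> $ itinerary \<sigma> j) <..<
         \<alpha> $ Min UNIV + (\<Sum>j\<in>{0..k}. \<beta> $ itinerary \<sigma> j - \<alpha> $ itinerary \<sigma> j)} = {W.pos k<..<W.pos (Suc k)}"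
    if "k \<in> {1..CARD('n) - 1}" for k
  proof -
    \<comment> \<open>This relies on k being at least 1: for k = 0 truncated subtraction would leave
      the index 0 in the first range.\<close>
    have "{0..k - 1} = {..<k}" "{0..k} = {..<Suc k}" using that by auto
    then show ?thesis by (simp only: W.pos_def W.len_def)
  qed
  \<comment> \<open>Index 0 is split off because the first interval stays in place, with \<tau>_0 =
    0.\<close>
  have indices: "{..<CARD('n)} = insert 0 {1..CARD('n) - 1}"
    using zero_less_card_finite[where 'a = 'n] by auto
  have "cycle_shift \<alpha> \<beta> \<sigma> 0 = 0" "itinerary \<sigma> 0 = Min UNIV"
    by (simp_all add: cycle_shift_def itinerary_def)
  then have union: "(\<Union>k<CARD('n). (+) (cycle_shift \<alpha> \<beta> \<sigma> k) ` {\<alpha> $ itinerary \<sigma> k<..<\<beta> $ itinerary \<sigma> k})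
      = {\<alpha> $ Min UNIV <..< \<beta> $ Min UNIV} \<union> (\<Union>k\<in>{1..CARD('n) - 1}.
          (+) (cycle_shift \<alpha> \<beta> \<sigma> k) ` {\<alpha> $ itinerary \<sigma> k <..< \<beta> $ itinerary \<sigma> k})"
    unfolding indices by simp
  show ?thesis
  proof (intro exI[of _ \<sigma>] exI[of _ "- \<mu> * L"] conjI allI ballI)
    show "\<Lambda> = (\<lambda>m. 1 / L * (m - (- \<mu> * L))) ` \<int>"
      using W.spectrum_eq[OF \<mu>] unfolding L .
    show "B $ i $ \<sigma> i = exp (2 * of_real pi * \<i> * of_real ((- \<mu> * L) / L * (\<alpha> $ \<sigma> i - \<beta> $ i)))" for i
      using W.weight_phase[OF \<mu>, of i] unfolding L .
    show "(+) (cycle_shift \<alpha> \<beta> \<sigma> k) ` {\<alpha> $ itinerary \<sigma> k <..< \<beta> $ itinerary \<sigma> k} =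
        {\<alpha> $ Min UNIV + (\<Sum>j\<in>{0..k - 1}. \<beta> $ itinerary \<sigma> j - \<alpha> $ itinerary \<sigma> j) <..<
         \<alpha> $ Min UNIV + (\<Sum>j\<in>{0..k}. \<beta> $ itinerary \<sigma> j - \<alpha> $ itinerary \<sigma> j)}"
      if "k \<in> {1..CARD('n) - 1}" for k
      unfolding cells[OF that] by (rule W.translate_interval)
    show "finite (sym_diff
       ({\<alpha> $ Min UNIV <..< \<beta> $ Min UNIV} \<union>
        (\<Union>k\<in>{1..CARD('n) - 1}.
           (+) (cycle_shift \<alpha> \<beta> \<sigma> k) ` {\<alpha> $ itinerary \<sigma> k <..< \<beta> $ itinerary \<sigma> k}))
       {\<alpha> $ Min UNIV <..< \<alpha> $ Min UNIV + L})"
      using W.finite_missing unfolding union L .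
    show "cycle_shift \<alpha> \<beta> \<sigma> k \<in> (\<lambda>m. L * m) ` \<int>" for k
      using m[of k] by (metis Ints_of_int imageI mult.commute)
    show "\<exists>P' m. (\<forall>k<CARD('n). of_int (m k) * L = cycle_shift \<alpha> \<beta> \<sigma> k) \<and>
        translation_congruence L (Omega \<alpha> \<beta>) {\<alpha> $ Min UNIV <..< \<alpha> $ Min UNIV + L}
          {..<CARD('n)} (\<lambda>k. {\<alpha> $ itinerary \<sigma> k <..< \<beta> $ itinerary \<sigma> k}) P' m"
      using congruence m by blast
    show "translation_congruent L (Omega \<alpha> \<beta>) {\<alpha> $ Min UNIV <..< \<alpha> $ Min UNIV + L}"
      using congruence unfolding translation_congruent_def by blast
    show "tiles (Omega \<alpha> \<beta>) ((\<lambda>m. L * m) ` \<int>)"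
      using W.tiles_lattice unfolding L .
    show "\<alpha> $ \<sigma> i - \<beta> $ i \<in> (\<lambda>m. L * m) ` \<int>" for i
      using W.gap_in_lattice[of i] unfolding L .
  qed (fact \<sigma> W.cyclic)+
qed

end
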